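(* Let $(X,\mu)$ be a discrete measure space and let $T\colon X\to X$ be a map such that $h_T\in L^\infty(\mu)$ and $G_T$ is connected and of one-cycle type (with notation $\kappa$, $v_0,\ldots,v_{\kappa-1}$, $\mathcal R$, $\omega_R$, $i_R$ as in the context). Let $m\ge 2$ be an integer. Then the following conditions are equivalent: (i) $S_{\lambda_T}$ is $m$-isometric; (ii) for every $v\in V_T\setminus\{v_0,\ldots,v_{\kappa-1}\}$ there exists a unique polynomial $p_v\in\mathbb R_{m-2}[x]$ satisfying $p_v(n)=\|S_{\lambda_T}^n e_v\|^2$ for all $n\in\mathbb N$, and, if $\kappa>1$, $m=\operatorname{rank}\tilde A_{m,\kappa}=\operatorname{rank}\tilde B_{m,\kappa}$, where $$\tilde A_{m,\kappa}=\begin{bmatrix}A_{m,\kappa}& b\end{bmatrix},\qquad \tilde B_{m,\kappa}=\begin{bmatrix}A_{m,\kappa}& b\\ B_{m,\kappa}& a\end{bmatrix},$$ $b=[\,b_{m-2}\ b_{m-3}\ \ldots\ b_0\ 1\,]^{T}$, $a=[\,a_1\ a_2\ \ldots\ a_{\kappa-1}\,]^T$, $a_i=\|S_{\lambda_T}^i e_{v_0}\|^2$, and $q(x)=\sum_{i=0}^{m-2}b_i x^i\in\mathbb R_{m-2}[x]$ is the polynomial defined by $$q(x)=\sum_{i=0}^{\kappa-1}\Lambda_{0,i}^2\sum_{\substack{R\in\mathcal R\\ i_R=i}}\lambda_{\omega_R}^2\,p_{\omega_R}(x+\kappa-i-1),\qquad x\in\mathbb R$$ (under the first condition in (ii), this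 formula does define a polynomial of degree at most $m-2$). Moreover, if (ii) holds, then the polynomial $p_{v_0}$ satisfying $p_{v_0}(n)=\|S_{\lambda_T}^n e_{v_0}\|^2$ for all $n\in\mathbb N$ is $p_{v_0}(x)=\sum_{j=0}^{m-1}c_jx^j$, where $c=(c_{m-1},\ldots,c_0)^T$ is the solution of $A_{m,\kappa}c=b$.
   Context: $\mathbb N=\{0,1,2,\ldots\}$; $\mathbb R_n[x]$ is the set of real polynomials of degree at most $n$. A discrete measure space is a pair $(X,\mu)$ with $X$ an at most countable (non-empty) set and $\mu\colon 2^X\to[0,\infty]$ a measure with $\mu(x):=\mu(\{x\})\in(0,\infty)$ for all $x\in X$. For $T\colon X\to X$ put $h_T(x)=\mu(T^{-1}(\{x\}))/\mu(x)$. The graph $G_T=(V_T,E_T)$ has $V_T=X$ and $E_T=\{(Tx,x):x\in X\}$. For $v\in V_T$ put $\lambda_v=\sqrt{\mu(v)}/\sqrt{\mu(Tv)}$. If $h_T\in L^\infty(\mu)$, then $S_{\lambda_T}$ is the bounded linear operator on the complex Hilbert space $\ell^2(V_T)$, with standard orthonormal basis $(e_v)_{v\in V_T}$, given by $S_{\lambda_T}e_u=\sum_{v\in V_T,\,Tv=u}\lambda_v e_v$. A graph is connected if any two distinct vertices can be joined by a finite sequence of vertices in which consecutive ones are joined by an edge in one direction or the other. A directed tree is a connected directed graph with every in-degree at most $1$ and no cycle (path $(u_0,\ldots,u_k)$, $k\ge1$, with $u_0=u_k$); its root, if it exists, is its unique vertex of in-degree $0$, and the tree is then called rooted. $G_T$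 is of one-cycle type if: (a) there are $\kappa\ge1$ and distinct vertices $v_0,\ldots,v_{\kappa-1}\in V_T$ with $(v_j,v_{j+1})\in E_T$ for $0\le j\le\kappa-2$ and $(v_{\kappa-1},v_0)\in E_T$; (b) there is a partition $\mathcal R$ of $V_T\setminus\{v_0,\ldots,v_{\kappa-1}\}$ such that for every $R\in\mathcal R$ the graph $(R,E_T\cap(R\times R))$ is a rooted directed tree whose root $\omega_R$ has the property that there is exactly one $i_R\in\{0,\ldots,\kappa-1\}$ with $(v_{i_R},\omega_R)\in E_T$. Put $\Lambda_{l,i}=\prod_{j=l+1}^{l+i}\lambda_{v_{j\bmod\kappa}}$ for $0\le l\le\kappa-1$, $i\in\mathbb N$ (empty product $=1$). An operator $S\in\mathbf B(H)$ is $m$-isometric if $\sum_{k=0}^m(-1)^{m-k}\binom mk S^{*k}S^k=0$. For integers $m\ge2$, $\kappa\ge1$, let $d_{i,j}=\binom{m-i}{m-j-i}\kappa^j$ for $i,j\ge1$ with $i+j\le m$, and let $A_{m,\kappa}$ be the $m\times m$ matrix $$A_{m,\kappa}=\begin{bmatrix}d_{1,1}&0&0&\ldots&0&0\\ d_{1,2}&d_{2,1}&0&\ldots&0&0\\ \vdots&\vdots&\vdots&&\vdots&\vdots\\ d_{1,m-1}&d_{2,m-2}&d_{3,m-3}&\ldots&d_{m-1,1}&0\\ 0&0&0&\ldots&0&1\end{bmatrix},$$ i.e. for $1\le r\le m-1$ the entry in row $r$, column $i$ is $d_{i,r+1-i}$ if $i\le r$ and $0$ otherwise, and the last row is $(0,\ldots,0,1)$.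 If $\kappa>1$, $B_{m,\kappa}$ is the $(\kappa-1)\times m$ matrix whose $\ell$-th row is $(\ell^{m-1},\ell^{m-2},\ldots,\ell^0)$, $\ell=1,\ldots,\kappa-1$. *)

theory Defs
  imports
    "HOL-Analysis.Analysis"
    "HOL-Probability.Essential_Supremum"
    "Graph_Theory.Digraph_Component"
    "Jordan_Normal_Form.DL_Rank"
begin

section \<open>The Hilbert space of square-summable functions and its operators\<close>

text \<open>
  The complex Hilbert space $\ell^2(V)$ is a carrier set: the functions that vanish outside \<open>V\<close>
  and are square-summable on \<open>V\<close>.  The inner product is linear in the first argument.
\<close>

definition ell2 :: "'a set \<Rightarrow> ('a \<Rightarrow> complex) set" where
  "ell2 V = {f. (\<forall>x. x \<notin> V \<longrightarrow> f x = 0) \<and> (\<lambda>x. (cmod (f x))\<^sup>2) summable_on V}"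

definition ell2_inner :: "'a set \<Rightarrow> ('a \<Rightarrow> complex) \<Rightarrow> ('a \<Rightarrow> complex) \<Rightarrow> complex" where
  "ell2_inner V f g = (\<Sum>\<^sub>\<infinity>x\<in>V. f x * cnj (g x))"

definition ell2_norm :: "'a set \<Rightarrow> ('a \<Rightarrow> complex) \<Rightarrow> real" where
  "ell2_norm V f = sqrt (\<Sum>\<^sub>\<infinity>x\<in>V. (cmod (f x))\<^sup>2)"

definition ell2_basis :: "'a \<Rightarrow> 'a \<Rightarrow> complex" where
  "ell2_basis u = (\<lambda>x. if x = u then 1 else 0)"

text \<open>Unconditional convergence in norm of a family of vectors indexed by \<open>A\<close>.\<close>

definition ell2_has_sum ::
    "'a set \<Rightarrow> ('b \<Rightarrow> 'a \<Rightarrow> complex) \<Rightarrow> ('a \<Rightarrow> complex) \<Rightarrow> 'b set \<Rightarrow> bool" where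
  "ell2_has_sum V g f A \<longleftrightarrow>
     ((\<lambda>F. ell2_norm V (\<lambda>x. f x - (\<Sum>a\<in>F. g a x))) \<longlongrightarrow> 0) (finite_subsets_at_top A)"

definition bounded_op :: "'a set \<Rightarrow> (('a \<Rightarrow> complex) \<Rightarrow> ('a \<Rightarrow> complex)) \<Rightarrow> bool" where
  "bounded_op V S \<longleftrightarrow>
     (\<forall>f\<in>ell2 V. S f \<in> ell2 V) \<and>
     (\<forall>f\<in>ell2 V. \<forall>g\<in>ell2 V. S (\<lambda>x. f x + g x) = (\<lambda>x. S f x + S g x)) \<and>
     (\<forall>f\<in>ell2 V. \<forall>c. S (\<lambda>x. c * f x) = (\<lambda>x. c * S f x)) \<and>
     (\<exists>C. \<forall>f\<in>ell2 V. ell2_norm V (S f) \<le> C * ell2_norm V f)"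

definition ell2_adjoint ::
    "'a set \<Rightarrow> (('a \<Rightarrow> complex) \<Rightarrow> ('a \<Rightarrow> complex)) \<Rightarrow> ('a \<Rightarrow> complex) \<Rightarrow> ('a \<Rightarrow> complex)" where
  "ell2_adjoint V S g =
     (THE h. h \<in> ell2 V \<and> (\<forall>f\<in>ell2 V. ell2_inner V (S f) g = ell2_inner V f h))"

definition m_isometric ::
    "'a set \<Rightarrow> nat \<Rightarrow> (('a \<Rightarrow> complex) \<Rightarrow> ('a \<Rightarrow> complex)) \<Rightarrow> bool" where
  "m_isometric V m S \<longleftrightarrow> bounded_op V S \<and>
     (\<forall>f\<in>ell2 V. \<forall>x\<in>V.
        (\<Sum>k\<le>m. (- 1) ^ (m - k) * of_nat (m choose k) *
           ((ell2_adjoint V S ^^ k) ((S ^^ k) f)) x) = 0)"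

section \<open>Discrete measure spaces and the weighted shift of a self-map\<close>

definition discrete_measure_space :: "'a measure \<Rightarrow> bool" where
  "discrete_measure_space M \<longleftrightarrow>
     space M \<noteq> {} \<and> countable (space M) \<and> sets M = Pow (space M) \<and>
     (\<forall>x\<in>space M. 0 < emeasure M {x} \<and> emeasure M {x} < \<infinity>)"

definition h_fun :: "'a measure \<Rightarrow> ('a \<Rightarrow> 'a) \<Rightarrow> 'a \<Rightarrow> ennreal" where
  "h_fun M T x = emeasure M (T -` {x} \<inter> space M) / emeasure M {x}"

definition weight :: "'a measure \<Rightarrow> ('a \<Rightarrow> 'a) \<Rightarrow> 'a \<Rightarrow> real" where
  "weight M T x = sqrt (measure M {x}) / sqrt (measure M {T x})"

text \<open>
  The shift is the bounded operator determined by its values on the basis.  As a HOL function it is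
  made unique by the convention that it is \<open>0\<close> on arguments outside \<open>ell2 (space M)\<close>;
  existence and uniqueness are established in \<open>shift_unique\<close> below.
\<close>

definition is_shift ::
    "'a measure \<Rightarrow> ('a \<Rightarrow> 'a) \<Rightarrow> (('a \<Rightarrow> complex) \<Rightarrow> ('a \<Rightarrow> complex)) \<Rightarrow> bool" where
  "is_shift M T S \<longleftrightarrow>
     bounded_op (space M) S \<and>
     (\<forall>f. f \<notin> ell2 (space M) \<longrightarrow> S f = (\<lambda>_. 0)) \<and>
     (\<forall>u\<in>space M. ell2_has_sum (space M)
        (\<lambda>v x. complex_of_real (weight M T v) * ell2_basis v x)
        (S (ell2_basis u)) {v \<in> space M. T v = u})"

definition shift :: "'a measure \<Rightarrow> ('a \<Rightarrow> 'a) \<Rightarrow> ('a \<Rightarrow> complex) \<Rightarrow> ('a \<Rightarrow> complex)" where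
  "shift M T = (THE S. is_shift M T S)"

definition orbit_norm2 :: "'a measure \<Rightarrow> ('a \<Rightarrow> 'a) \<Rightarrow> 'a \<Rightarrow> nat \<Rightarrow> real" where
  "orbit_norm2 M T x n = (ell2_norm (space M) ((shift M T ^^ n) (ell2_basis x)))\<^sup>2"

section \<open>Graphs of one-cycle type\<close>

definition map_graph :: "'a measure \<Rightarrow> ('a \<Rightarrow> 'a) \<Rightarrow> ('a, 'a \<times> 'a) pre_digraph" where
  "map_graph M T = with_proj \<lparr> pverts = space M, parcs = {(T x, x) | x. x \<in> space M} \<rparr>"

text \<open>
  \<open>in_degree\<close> is a cardinality, hence \<open>0\<close> for infinitely many incoming arcs; finiteness is
  therefore required separately.
\<close>

definition directed_tree :: "('a, 'b) pre_digraph \<Rightarrow> bool" where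
  "directed_tree G \<longleftrightarrow>
     Digraph_Component.connected G \<and>
     (\<forall>x\<in>verts G. finite (in_arcs G x) \<and> in_degree G x \<le> 1) \<and>
     (\<forall>x\<in>verts G. \<not> x \<rightarrow>\<^sup>+\<^bsub>G\<^esub> x)"

definition is_root :: "('a, 'b) pre_digraph \<Rightarrow> 'a \<Rightarrow> bool" where
  "is_root G r \<longleftrightarrow> r \<in> verts G \<and> in_degree G r = 0"

definition rooted_directed_tree :: "('a, 'b) pre_digraph \<Rightarrow> bool" where
  "rooted_directed_tree G \<longleftrightarrow> directed_tree G \<and> (\<exists>!r. is_root G r)"

definition root_of :: "('a, 'b) pre_digraph \<Rightarrow> 'a" where
  "root_of G = (THE r. is_root G r)"

text \<open>
  \<open>one_cycle_type_with G \<kappa> v \<R>\<close>: the graph is of one-cycle type, witnessed by the cycle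
  \<open>v 0, \<dots>, v (\<kappa> - 1)\<close> and the partition \<open>\<R>\<close>; the values of \<open>v\<close> at
  arguments \<open>\<ge> \<kappa>\<close> are irrelevant.
\<close>

definition one_cycle_type_with ::
    "('a, 'b) pre_digraph \<Rightarrow> nat \<Rightarrow> (nat \<Rightarrow> 'a) \<Rightarrow> 'a set set \<Rightarrow> bool" where
  "one_cycle_type_with G \<kappa> v \<R> \<longleftrightarrow>
     1 \<le> \<kappa> \<and> v ` {..<\<kappa>} \<subseteq> verts G \<and> inj_on v {..<\<kappa>} \<and>
     (\<forall>j. j + 1 < \<kappa> \<longrightarrow> v j \<rightarrow>\<^bsub>G\<^esub> v (j + 1)) \<and>
     v (\<kappa> - 1) \<rightarrow>\<^bsub>G\<^esub> v 0 \<and>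
     partition_on (verts G - v ` {..<\<kappa>}) \<R> \<and>
     (\<forall>R\<in>\<R>. rooted_directed_tree (G \<restriction> R) \<and>
        (\<exists>!i. i < \<kappa> \<and> v i \<rightarrow>\<^bsub>G\<^esub> root_of (G \<restriction> R)))"

definition branch_index ::
    "('a, 'b) pre_digraph \<Rightarrow> nat \<Rightarrow> (nat \<Rightarrow> 'a) \<Rightarrow> 'a set \<Rightarrow> nat" where
  "branch_index G \<kappa> v R = (THE i. i < \<kappa> \<and> v i \<rightarrow>\<^bsub>G\<^esub> root_of (G \<restriction> R))"

definition cycle_weight ::
    "'a measure \<Rightarrow> ('a \<Rightarrow> 'a) \<Rightarrow> nat \<Rightarrow> (nat \<Rightarrow> 'a) \<Rightarrow> nat \<Rightarrow> nat \<Rightarrow> real" where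
  "cycle_weight M T \<kappa> v l i = (\<Prod>j=l+1..l+i. weight M T (v (j mod \<kappa>)))"

section \<open>The polynomials and the linear system\<close>

definition is_moment_poly ::
    "'a measure \<Rightarrow> ('a \<Rightarrow> 'a) \<Rightarrow> nat \<Rightarrow> 'a \<Rightarrow> real poly \<Rightarrow> bool" where
  "is_moment_poly M T m x p \<longleftrightarrow>
     degree p \<le> m - 2 \<and> (\<forall>n. poly p (real n) = orbit_norm2 M T x n)"

definition moment_poly :: "'a measure \<Rightarrow> ('a \<Rightarrow> 'a) \<Rightarrow> nat \<Rightarrow> 'a \<Rightarrow> real poly" where
  "moment_poly M T m x = (THE p. is_moment_poly M T m x p)"

definition moment_condition ::
    "'a measure \<Rightarrow> ('a \<Rightarrow> 'a) \<Rightarrow> nat \<Rightarrow> nat \<Rightarrow> (nat \<Rightarrow> 'a) \<Rightarrow> bool" where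
  "moment_condition M T m \<kappa> v \<longleftrightarrow>
     (\<forall>x \<in> space M - v ` {..<\<kappa>}. \<exists>!p. is_moment_poly M T m x p)"

text \<open>
  The family of trees attached to one vertex may be infinite; convergence of the resulting series at
  every real argument is part of the requirement.
\<close>

definition is_q_poly ::
    "'a measure \<Rightarrow> ('a \<Rightarrow> 'a) \<Rightarrow> nat \<Rightarrow> nat \<Rightarrow> (nat \<Rightarrow> 'a) \<Rightarrow> 'a set set \<Rightarrow> real poly \<Rightarrow> bool" where
  "is_q_poly M T m \<kappa> v \<R> q \<longleftrightarrow> degree q \<le> m - 2 \<and>
     (let G = map_graph M T;
          \<R>' = (\<lambda>i. {R \<in> \<R>. branch_index G \<kappa> v R = i});
          t = (\<lambda>i x R. (weight M T (root_of (G \<restriction> R)))\<^sup>2 *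
                 poly (moment_poly M T m (root_of (G \<restriction> R))) (x + real \<kappa> - real i - 1))
      in \<forall>x. (\<forall>i<\<kappa>. t i x summable_on \<R>' i) \<and>
             poly q x = (\<Sum>i<\<kappa>. (cycle_weight M T \<kappa> v 0 i)\<^sup>2 * (\<Sum>\<^sub>\<infinity>R\<in>\<R>' i. t i x R)))"

definition q_poly ::
    "'a measure \<Rightarrow> ('a \<Rightarrow> 'a) \<Rightarrow> nat \<Rightarrow> nat \<Rightarrow> (nat \<Rightarrow> 'a) \<Rightarrow> 'a set set \<Rightarrow> real poly" where
  "q_poly M T m \<kappa> v \<R> = (THE q. is_q_poly M T m \<kappa> v \<R> q)"

definition d_coeff :: "nat \<Rightarrow> nat \<Rightarrow> nat \<Rightarrow> nat \<Rightarrow> real" where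
  "d_coeff m \<kappa> i j = real ((m - i) choose (m - j - i)) * real \<kappa> ^ j"

text \<open>Rows and columns of the library's matrices are numbered from \<open>0\<close>.\<close>

definition A_mat :: "nat \<Rightarrow> nat \<Rightarrow> real mat" where
  "A_mat m \<kappa> = mat m m (\<lambda>(r0, i0). let r = r0 + 1; i = i0 + 1 in
     if r = m then (if i = m then 1 else 0)
     else if i \<le> r then d_coeff m \<kappa> i (r + 1 - i) else 0)"

definition B_mat :: "nat \<Rightarrow> nat \<Rightarrow> real mat" where
  "B_mat m \<kappa> = mat (\<kappa> - 1) m (\<lambda>(l0, i0). real (l0 + 1) ^ (m - 1 - i0))"

definition b_vec ::
    "'a measure \<Rightarrow> ('a \<Rightarrow> 'a) \<Rightarrow> nat \<Rightarrow> nat \<Rightarrow> (nat \<Rightarrow> 'a) \<Rightarrow> 'a set set \<Rightarrow> real Matrix.vec" where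
  "b_vec M T m \<kappa> v \<R> =
     Matrix.vec m (\<lambda>r. if r = m - 1 then 1 else poly.coeff (q_poly M T m \<kappa> v \<R>) (m - 2 - r))"

definition a_vec ::
    "'a measure \<Rightarrow> ('a \<Rightarrow> 'a) \<Rightarrow> nat \<Rightarrow> (nat \<Rightarrow> 'a) \<Rightarrow> real Matrix.vec" where
  "a_vec M T \<kappa> v = Matrix.vec (\<kappa> - 1) (\<lambda>l0. orbit_norm2 M T (v 0) (l0 + 1))"

definition A_tilde ::
    "'a measure \<Rightarrow> ('a \<Rightarrow> 'a) \<Rightarrow> nat \<Rightarrow> nat \<Rightarrow> (nat \<Rightarrow> 'a) \<Rightarrow> 'a set set \<Rightarrow> real mat" where
  "A_tilde M T m \<kappa> v \<R> = mat_of_cols m (cols (A_mat m \<kappa>) @ [b_vec M T m \<kappa> v \<R>])"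

definition B_tilde ::
    "'a measure \<Rightarrow> ('a \<Rightarrow> 'a) \<Rightarrow> nat \<Rightarrow> nat \<Rightarrow> (nat \<Rightarrow> 'a) \<Rightarrow> 'a set set \<Rightarrow> real mat" where
  "B_tilde M T m \<kappa> v \<R> = four_block_mat
     (A_mat m \<kappa>) (mat_of_cols m [b_vec M T m \<kappa> v \<R>])
     (B_mat m \<kappa>) (mat_of_cols (\<kappa> - 1) [a_vec M T \<kappa> v])"

definition rank_condition ::
    "'a measure \<Rightarrow> ('a \<Rightarrow> 'a) \<Rightarrow> nat \<Rightarrow> nat \<Rightarrow> (nat \<Rightarrow> 'a) \<Rightarrow> 'a set set \<Rightarrow> bool" where
  "rank_condition M T m \<kappa> v \<R> \<longleftrightarrow>
     m = vec_space.rank m (A_tilde M T m \<kappa> v \<R>) \<and>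
     m = vec_space.rank (m + (\<kappa> - 1)) (B_tilde M T m \<kappa> v \<R>)"

text \<open>The coefficient vector lists the leading coefficient first: $c = (c_{m-1},\ldots,c_0)^T$.\<close>

definition poly_of_coeffs :: "nat \<Rightarrow> real Matrix.vec \<Rightarrow> real poly" where
  "poly_of_coeffs m c = (\<Sum>j<m. monom (vec_index c (m - 1 - j)) j)"

section \<open>Well-definedness of the shift\<close>

lemma ell2_cong_le:
  assumes "f \<in> ell2 V" "\<And>x. x \<in> V \<Longrightarrow> cmod (g x) \<le> cmod (f x)" "\<And>x. x \<notin> V \<Longrightarrow> g x = 0"
  shows "g \<in> ell2 V"
proof -
  have "(\<lambda>x. (cmod (f x))\<^sup>2) summable_on V" using assms(1) by (simp add: ell2_def)
  then have "(\<lambda>x. (cmod (g x))\<^sup>2) summable_on V"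
    by (rule summable_on_comparison_test) (auto simp: assms(2) power_mono)
  then show ?thesis using assms(3) by (simp add: ell2_def)
qed

lemma ell2_basis_in: "u \<in> V \<Longrightarrow> ell2_basis u \<in> ell2 V"
proof -
  assume u: "u \<in> V"
  have "(\<lambda>x. (cmod (ell2_basis u x))\<^sup>2) summable_on V \<longleftrightarrow>
        (\<lambda>x. (cmod (ell2_basis u x))\<^sup>2) summable_on {u}"
    by (rule summable_on_cong_neutral) (auto simp: ell2_basis_def u)
  then show ?thesis using u by (auto simp: ell2_def ell2_basis_def)
qed

lemma ell2_pointwise_le:
  assumes "f \<in> ell2 V" "x \<in> V"
  shows "cmod (f x) \<le> ell2_norm V f"
proof -
  have "sum (\<lambda>x. (cmod (f x))\<^sup>2) {x} \<le> (\<Sum>\<^sub>\<infinity>x\<in>V. (cmod (f x))\<^sup>2)"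
    using assms by (intro finite_sum_le_infsum) (auto simp: ell2_def)
  then show ?thesis by (auto simp: ell2_norm_def intro: real_le_rsqrt)
qed

lemma ell2_truncate:
  assumes f: "f \<in> ell2 V" and A: "A \<subseteq> V" and supp: "\<And>x. x \<notin> A \<Longrightarrow> f x = 0"
  shows "((\<lambda>F. ell2_norm V (\<lambda>x. if x \<in> F then 0 else f x)) \<longlongrightarrow> 0) (finite_subsets_at_top A)"
proof -
  let ?s = "\<lambda>x. (cmod (f x))\<^sup>2"
  have smV: "?s summable_on V" using f by (simp add: ell2_def)
  have smA: "?s summable_on A" using summable_on_subset_banach[OF smV A] .
  have "((\<lambda>F. sum ?s F) \<longlongrightarrow> infsum ?s A) (finite_subsets_at_top A)"
    using smA by (simp add: has_sum_def[symmetric])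
  then have "((\<lambda>F. sqrt (infsum ?s A - sum ?s F)) \<longlongrightarrow> sqrt (infsum ?s A - infsum ?s A))
      (finite_subsets_at_top A)"
    by (intro tendsto_intros)
  moreover have "\<forall>\<^sub>F F in finite_subsets_at_top A.
      sqrt (infsum ?s A - sum ?s F) = ell2_norm V (\<lambda>x. if x \<in> F then 0 else f x)"
    unfolding eventually_finite_subsets_at_top
  proof (intro exI[of _ "{}"] conjI allI impI)
    fix F assume F: "finite F \<and> {} \<subseteq> F \<and> F \<subseteq> A"
    have "infsum ?s (A - F) = infsum ?s A - infsum ?s F"
      using F smA by (intro infsum_Diff) auto
    moreover have "infsum ?s (A - F) =
        (\<Sum>\<^sub>\<infinity>x\<in>V. (cmod (if x \<in> F then 0 else f x))\<^sup>2)"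
      by (rule infsum_cong_neutral) (use A supp F in auto)
    ultimately show "sqrt (infsum ?s A - sum ?s F) = ell2_norm V (\<lambda>x. if x \<in> F then 0 else f x)"
      using F by (simp add: ell2_norm_def)
  qed auto
  ultimately show ?thesis using Lim_transform_eventually by fastforce
qed

lemma bounded_opD:
  assumes "bounded_op V S" "f \<in> ell2 V"
  shows "S f \<in> ell2 V" "S (\<lambda>x. c * f x) = (\<lambda>x. c * S f x)"
    "g \<in> ell2 V \<Longrightarrow> S (\<lambda>x. f x + g x) = (\<lambda>x. S f x + S g x)"
  using assms unfolding bounded_op_def by auto

lemma bounded_op_finite:
  assumes S: "bounded_op V S" and "finite F" "F \<subseteq> V"
  shows "(\<lambda>x. if x \<in> F then f x else 0) \<in> ell2 V \<and>
    S (\<lambda>x. if x \<in> F then f x else 0) = (\<lambda>x. \<Sum>u\<in>F. f u * S (ell2_basis u) x)"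
  using assms(2,3)
proof (induction F rule: finite_induct)
  case empty
  have z: "(\<lambda>x. 0) \<in> ell2 V" by (simp add: ell2_def)
  have "S (\<lambda>x. 0 * 0) = (\<lambda>x. 0 * S (\<lambda>x. 0) x)"
    by (rule bounded_opD(2)[OF S z])
  then show ?case using z by simp
next
  case (insert a F)
  have ea: "ell2_basis a \<in> ell2 V" using insert by (simp add: ell2_basis_in)
  have fa: "(\<lambda>x. f a * ell2_basis a x) \<in> ell2 V"
  proof -
    have "(\<lambda>x. (cmod (ell2_basis a x))\<^sup>2) summable_on V" using ea by (simp add: ell2_def)
    then have "(\<lambda>x. (cmod (f a))\<^sup>2 * (cmod (ell2_basis a x))\<^sup>2) summable_on V"
      by (rule summable_on_cmult_right)
    then show ?thesis using ea by (auto simp: ell2_def norm_mult power_mult_distrib)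
  qed
  let ?g = "\<lambda>x. if x \<in> F then f x else 0"
  have g: "?g \<in> ell2 V" "S ?g = (\<lambda>x. \<Sum>u\<in>F. f u * S (ell2_basis u) x)" using insert by auto
  have eq: "(\<lambda>x. if x \<in> insert a F then f x else 0) = (\<lambda>x. f a * ell2_basis a x + ?g x)"
    using insert(2) by (auto simp: ell2_basis_def fun_eq_iff)
  have mem: "(\<lambda>x. if x \<in> insert a F then f x else 0) \<in> ell2 V"
  proof -
    have "(\<lambda>x. (cmod (f a * ell2_basis a x))\<^sup>2 + (cmod (?g x))\<^sup>2) summable_on V"
      using fa g(1) by (intro summable_on_add) (auto simp: ell2_def)
    moreover have "(cmod (f a * ell2_basis a x))\<^sup>2 + (cmod (?g x))\<^sup>2 =
        (cmod (if x \<in> insert a F then f x else 0))\<^sup>2" for x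
      using insert(2) by (auto simp: ell2_basis_def)
    ultimately show ?thesis using insert.prems by (auto simp: ell2_def)
  qed
  have "S (\<lambda>x. f a * ell2_basis a x + ?g x) = (\<lambda>x. S (\<lambda>x. f a * ell2_basis a x) x + S ?g x)"
    by (rule bounded_opD(3)[OF S fa g(1)])
  moreover have "S (\<lambda>x. f a * ell2_basis a x) = (\<lambda>x. f a * S (ell2_basis a) x)"
    by (rule bounded_opD(2)[OF S ea])
  ultimately have "S (\<lambda>x. if x \<in> insert a F then f x else 0) =
      (\<lambda>x. \<Sum>u\<in>insert a F. f u * S (ell2_basis u) x)"
    unfolding eq using insert(1,2) g(2) by simp
  then show ?case using mem by blast
qed

lemma bounded_op_determined:
  assumes S: "bounded_op V S" and S': "bounded_op V S'"
    and eq: "\<And>u. u \<in> V \<Longrightarrow> S (ell2_basis u) = S' (ell2_basis u)"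
    and f: "f \<in> ell2 V"
  shows "S f = S' f"
proof
  fix x
  have *: "((\<lambda>F. \<Sum>u\<in>F. f u * Q (ell2_basis u) x) \<longlongrightarrow> Q f x) (finite_subsets_at_top V)"
    if Q: "bounded_op V Q" and x: "x \<in> V" for Q
  proof -
    obtain C where C: "\<And>g. g \<in> ell2 V \<Longrightarrow> ell2_norm V (Q g) \<le> C * ell2_norm V g"
      using Q unfolding bounded_op_def by blast
    let ?r = "\<lambda>F x. if x \<in> F then 0 else f x"
    let ?g = "\<lambda>F x. if x \<in> F then f x else 0"
    have "((\<lambda>F. C * ell2_norm V (?r F)) \<longlongrightarrow> C * 0) (finite_subsets_at_top V)"
      using f by (intro tendsto_intros ell2_truncate) (auto simp: ell2_def)
    then have lim: "((\<lambda>F. C * ell2_norm V (?r F)) \<longlongrightarrow> 0) (finite_subsets_at_top V)" by simp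
    have "\<forall>\<^sub>F F in finite_subsets_at_top V.
        norm ((\<Sum>u\<in>F. f u * Q (ell2_basis u) x) - Q f x) \<le> C * ell2_norm V (?r F)"
      unfolding eventually_finite_subsets_at_top
    proof (intro exI[of _ "{}"] conjI allI impI)
      fix F assume F: "finite F \<and> {} \<subseteq> F \<and> F \<subseteq> V"
      have g: "?g F \<in> ell2 V" "Q (?g F) = (\<lambda>x. \<Sum>u\<in>F. f u * Q (ell2_basis u) x)"
        using bounded_op_finite[OF Q, of F f] F by auto
      have r: "?r F \<in> ell2 V" by (rule ell2_cong_le[OF f]) (use f in \<open>auto simp: ell2_def\<close>)
      have "f = (\<lambda>x. ?g F x + ?r F x)" by auto
      then have "Q f = Q (\<lambda>x. ?g F x + ?r F x)" by simp
      also have "\<dots> = (\<lambda>x. Q (?g F) x + Q (?r F) x)"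
        by (rule bounded_opD(3)[OF Q g(1) r])
      finally have "Q f x - (\<Sum>u\<in>F. f u * Q (ell2_basis u) x) = Q (?r F) x"
        using g(2) by (simp add: fun_eq_iff)
      moreover have "Q (?r F) \<in> ell2 V" by (rule bounded_opD(1)[OF Q r])
      ultimately show "norm ((\<Sum>u\<in>F. f u * Q (ell2_basis u) x) - Q f x) \<le> C * ell2_norm V (?r F)"
        using ell2_pointwise_le[of "Q (?r F)" V x] C[OF r] x by (simp add: norm_minus_commute)
    qed auto
    then have "((\<lambda>F. (\<Sum>u\<in>F. f u * Q (ell2_basis u) x) - Q f x) \<longlongrightarrow> 0)
        (finite_subsets_at_top V)"
      using lim by (rule Lim_null_comparison)
    then show ?thesis by (rule Lim_null[THEN iffD2])
  qed
  show "S f x = S' f x"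
  proof (cases "x \<in> V")
    case True
    have "\<forall>\<^sub>F F in finite_subsets_at_top V.
        (\<Sum>u\<in>F. f u * S (ell2_basis u) x) = (\<Sum>u\<in>F. f u * S' (ell2_basis u) x)"
      unfolding eventually_finite_subsets_at_top
      by (intro exI[of _ "{}"]) (auto intro!: sum.cong simp: eq subset_iff)
    then have "((\<lambda>F. \<Sum>u\<in>F. f u * S' (ell2_basis u) x) \<longlongrightarrow> S f x) (finite_subsets_at_top V)"
      by (rule Lim_transform_eventually[OF *[OF S True]])
    then show ?thesis
      using *[OF S' True] by (rule tendsto_unique[OF finite_subsets_at_top_neq_bot])
  next
    case False
    then show ?thesis
      using bounded_opD(1)[OF S f] bounded_opD(1)[OF S' f] by (simp add: ell2_def)
  qed
qed

lemma weight_fiber_bound: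
  assumes M: "discrete_measure_space M" and T: "T \<in> space M \<rightarrow> space M"
    and h: "esssup M (h_fun M T) < \<infinity>"
  obtains C :: real where "C \<ge> 0"
    "\<And>u F. u \<in> space M \<Longrightarrow> finite F \<Longrightarrow> F \<subseteq> space M \<Longrightarrow> (\<And>v. v \<in> F \<Longrightarrow> T v = u) \<Longrightarrow>
      (\<Sum>v\<in>F. (weight M T v)\<^sup>2) \<le> C"
proof -
  define c where "c = enn2real (esssup M (h_fun M T))"
  have c: "esssup M (h_fun M T) = ennreal c" "c \<ge> 0" using h by (auto simp: c_def top.not_eq_extremum)
  have sets: "A \<in> sets M \<longleftrightarrow> A \<subseteq> space M" for A using M by (auto simp: discrete_measure_space_def)
  have fin: "emeasure M {x} = ennreal (measure M {x})" "measure M {x} > 0" if "x \<in> space M" for x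
    using that M by (auto simp: discrete_measure_space_def measure_def enn2real_positive_iff
        less_top[symmetric])
  have hle: "h_fun M T x \<le> ennreal c" if x: "x \<in> space M" for x
  proof (rule ccontr)
    assume n: "\<not> h_fun M T x \<le> ennreal c"
    have "AE x in M. h_fun M T x \<le> ennreal c" using esssup_AE[where M=M and f="h_fun M T"] c by simp
    then obtain N where N: "{x \<in> space M. \<not> h_fun M T x \<le> ennreal c} \<subseteq> N" "emeasure M N = 0" "N \<in> sets M"
      by (rule AE_E)
    then have "emeasure M {x} \<le> emeasure M N" using x n by (intro emeasure_mono) auto
    then show False using N fin[OF x] by (simp add: ennreal_eq_0_iff)
  qed
  show thesis
  proof (rule that[OF c(2)])
    fix u F assume u: "u \<in> space M" and F: "finite F" "F \<subseteq> space M" "\<And>v. v \<in> F \<Longrightarrow> T v = u"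
    have "(\<Sum>v\<in>F. ennreal (measure M {v})) = (\<Sum>v\<in>F. emeasure M {v})"
      using F(2) fin(1) by (intro sum.cong) auto
    then have "ennreal (\<Sum>v\<in>F. measure M {v}) = (\<Sum>v\<in>F. emeasure M {v})"
      by simp
    also have "\<dots> = emeasure M F"
      using F sets by (intro emeasure_eq_sum_singleton[symmetric]) auto
    also have "\<dots> \<le> emeasure M (T -` {u} \<inter> space M)"
      using F sets by (intro emeasure_mono) auto
    also have "\<dots> = h_fun M T u * emeasure M {u}"
      using fin[OF u] by (simp add: h_fun_def ennreal_divide_times ennreal_mult_divide_eq)
    also have "\<dots> \<le> ennreal c * ennreal (measure M {u})"
      using hle[OF u] fin(1)[OF u] by (simp add: mult_right_mono)
    also have "\<dots> = ennreal (c * measure M {u})" using c by (simp add: ennreal_mult)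
    finally have "(\<Sum>v\<in>F. measure M {v}) \<le> c * measure M {u}"
      using c by (simp add: ennreal_le_iff)
    moreover have "(\<Sum>v\<in>F. (weight M T v)\<^sup>2) = (\<Sum>v\<in>F. measure M {v}) / measure M {u}"
      using F by (auto simp: weight_def power_divide sum_divide_distrib intro!: sum.cong)
    ultimately show "(\<Sum>v\<in>F. (weight M T v)\<^sup>2) \<le> c"
      using fin(2)[OF u] by (simp add: divide_le_eq)
  qed
qed

definition shift_formula :: "'a measure \<Rightarrow> ('a \<Rightarrow> 'a) \<Rightarrow> ('a \<Rightarrow> complex) \<Rightarrow> ('a \<Rightarrow> complex)" where
  "shift_formula M T f =
     (\<lambda>v. if v \<in> space M then complex_of_real (weight M T v) * f (T v) else 0)"

lemma shift_formula_bounded_op: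
  assumes M: "discrete_measure_space M" and T: "T \<in> space M \<rightarrow> space M"
    and h: "esssup M (h_fun M T) < \<infinity>"
  shows "bounded_op (space M) (shift_formula M T)"
proof -
  obtain C :: real where C: "C \<ge> 0"
    and bnd: "\<And>u F. u \<in> space M \<Longrightarrow> finite F \<Longrightarrow> F \<subseteq> space M \<Longrightarrow> (\<And>v. v \<in> F \<Longrightarrow> T v = u) \<Longrightarrow>
      (\<Sum>v\<in>F. (weight M T v)\<^sup>2) \<le> C"
    using weight_fiber_bound[OF M T h] by blast
  have key: "(\<Sum>v\<in>F. (cmod (shift_formula M T f v))\<^sup>2) \<le> C * (\<Sum>\<^sub>\<infinity>x\<in>space M. (cmod (f x))\<^sup>2)"
    if f: "f \<in> ell2 (space M)" and F: "finite F" "F \<subseteq> space M" for f F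
  proof -
    have "(\<Sum>v\<in>F. (cmod (shift_formula M T f v))\<^sup>2)
        = (\<Sum>v\<in>F. (weight M T v)\<^sup>2 * (cmod (f (T v)))\<^sup>2)"
      using F by (intro sum.cong) (auto simp: shift_formula_def norm_mult power_mult_distrib)
    also have "\<dots> = (\<Sum>u\<in>T ` F. \<Sum>v\<in>{v\<in>F. T v = u}. (weight M T v)\<^sup>2 * (cmod (f (T v)))\<^sup>2)"
      by (rule sum.image_gen[OF F(1)])
    also have "\<dots> = (\<Sum>u\<in>T ` F. (\<Sum>v\<in>{v\<in>F. T v = u}. (weight M T v)\<^sup>2) * (cmod (f u))\<^sup>2)"
      by (auto simp: sum_distrib_right intro!: sum.cong)
    also have "\<dots> \<le> (\<Sum>u\<in>T ` F. C * (cmod (f u))\<^sup>2)"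
      using F T by (intro sum_mono mult_right_mono bnd) auto
    also have "\<dots> = C * (\<Sum>u\<in>T ` F. (cmod (f u))\<^sup>2)" by (simp add: sum_distrib_left)
    also have "\<dots> \<le> C * (\<Sum>\<^sub>\<infinity>x\<in>space M. (cmod (f x))\<^sup>2)"
      using f F T C by (intro mult_left_mono finite_sum_le_infsum) (auto simp: ell2_def)
    finally show ?thesis .
  qed
  have mem: "shift_formula M T f \<in> ell2 (space M)" if f: "f \<in> ell2 (space M)" for f
  proof -
    have "(\<lambda>x. (cmod (shift_formula M T f x))\<^sup>2) summable_on space M"
      using key[OF f] by (intro nonneg_bdd_above_summable_on bdd_aboveI2) auto
    then show ?thesis by (simp add: ell2_def shift_formula_def)
  qed
  have "ell2_norm (space M) (shift_formula M T f) \<le> sqrt C * ell2_norm (space M) f"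
    if f: "f \<in> ell2 (space M)" for f
  proof -
    have "(\<Sum>\<^sub>\<infinity>x\<in>space M. (cmod (shift_formula M T f x))\<^sup>2)
        \<le> C * (\<Sum>\<^sub>\<infinity>x\<in>space M. (cmod (f x))\<^sup>2)"
      using mem[OF f] key[OF f] by (intro infsum_le_finite_sums) (auto simp: ell2_def)
    then show ?thesis by (simp add: ell2_norm_def real_sqrt_mult[symmetric])
  qed
  then show ?thesis using mem unfolding bounded_op_def
    by (auto simp: shift_formula_def algebra_simps fun_eq_iff)
qed

lemma shift_formula_basis:
  assumes M: "discrete_measure_space M" and T: "T \<in> space M \<rightarrow> space M"
    and h: "esssup M (h_fun M T) < \<infinity>" and u: "u \<in> space M"
  shows "ell2_has_sum (space M) (\<lambda>v x. complex_of_real (weight M T v) * ell2_basis v x)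
    (shift_formula M T (ell2_basis u)) {v \<in> space M. T v = u}"
proof -
  let ?A = "{v \<in> space M. T v = u}" and ?f = "shift_formula M T (ell2_basis u)"
  let ?w = "\<lambda>v x. complex_of_real (weight M T v) * ell2_basis v x"
  have f: "?f \<in> ell2 (space M)"
    using bounded_opD(1)[OF shift_formula_bounded_op[OF M T h] ell2_basis_in[OF u]] .
  have "((\<lambda>F. ell2_norm (space M) (\<lambda>x. if x \<in> F then 0 else ?f x)) \<longlongrightarrow> 0) (finite_subsets_at_top ?A)"
    by (rule ell2_truncate[OF f]) (auto simp: shift_formula_def ell2_basis_def)
  moreover have "\<forall>\<^sub>F F in finite_subsets_at_top ?A.
      ell2_norm (space M) (\<lambda>x. if x \<in> F then 0 else ?f x)
      = ell2_norm (space M) (\<lambda>x. ?f x - (\<Sum>a\<in>F. ?w a x))"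
    unfolding eventually_finite_subsets_at_top
  proof (intro exI[of _ "{}"] conjI allI impI)
    fix F assume F: "finite F \<and> {} \<subseteq> F \<and> F \<subseteq> ?A"
    have "(\<Sum>a\<in>F. ?w a x) = (if x \<in> F then ?f x else 0)" for x
    proof -
      have "(\<Sum>a\<in>F. ?w a x) = (\<Sum>a\<in>F. if a = x then complex_of_real (weight M T x) else 0)"
        by (intro sum.cong) (auto simp: ell2_basis_def)
      then show ?thesis using F by (auto simp: shift_formula_def ell2_basis_def)
    qed
    then have "(\<lambda>x. ?f x - (\<Sum>a\<in>F. ?w a x)) = (\<lambda>x. if x \<in> F then 0 else ?f x)" by auto
    then show "ell2_norm (space M) (\<lambda>x. if x \<in> F then 0 else ?f x)
      = ell2_norm (space M) (\<lambda>x. ?f x - (\<Sum>a\<in>F. ?w a x))" by (rule arg_cong[symmetric])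
  qed auto
  ultimately show ?thesis unfolding ell2_has_sum_def by (rule Lim_transform_eventually)
qed

lemma ell2_has_sum_basis_value:
  assumes s: "ell2_has_sum V (\<lambda>v x. w v * ell2_basis v x) f A" and f: "f \<in> ell2 V"
    and A: "A \<subseteq> V" and x: "x \<in> V"
  shows "f x = (if x \<in> A then w x else 0)"
proof -
  let ?g = "\<lambda>F x. \<Sum>a\<in>F. w a * ell2_basis a x"
  have val: "?g F y = (if y \<in> F then w y else 0)" if "finite F" for F y
  proof -
    have "?g F y = (\<Sum>a\<in>F. if a = y then w y else 0)"
      by (intro sum.cong) (auto simp: ell2_basis_def)
    then show ?thesis using that by simp
  qed
  have "\<forall>\<^sub>F F in finite_subsets_at_top A.
      norm (f x - (if x \<in> A then w x else 0)) \<le> ell2_norm V (\<lambda>x. f x - ?g F x)"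
    unfolding eventually_finite_subsets_at_top
  proof (intro exI[of _ "A \<inter> {x}"] conjI allI impI)
    fix F assume F: "finite F \<and> A \<inter> {x} \<subseteq> F \<and> F \<subseteq> A"
    have d: "(\<lambda>x. (cmod (f x - ?g F x))\<^sup>2) summable_on V"
    proof -
      have "(\<lambda>x. (cmod (f x))\<^sup>2) summable_on V" using f by (simp add: ell2_def)
      then have "(\<lambda>x. (cmod (f x))\<^sup>2) summable_on V - F"
        by (rule summable_on_subset_banach) auto
      then have "(\<lambda>x. (cmod (f x - ?g F x))\<^sup>2) summable_on V - F"
        by (rule summable_on_cong[THEN iffD1, rotated]) (use F val in auto)
      moreover have "(\<lambda>x. (cmod (f x - ?g F x))\<^sup>2) summable_on F" using F by simp
      ultimately have "(\<lambda>x. (cmod (f x - ?g F x))\<^sup>2) summable_on ((V - F) \<union> F)"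
        by (rule summable_on_Un_disjoint) auto
      moreover have "(V - F) \<union> F = V" using F A by auto
      ultimately show ?thesis by simp
    qed
    have "?g F y = 0" if "y \<notin> V" for y using val[of F y] F A that by auto
    then have "(\<lambda>x. f x - ?g F x) \<in> ell2 V" using f d by (simp add: ell2_def)
    then have "cmod (f x - ?g F x) \<le> ell2_norm V (\<lambda>x. f x - ?g F x)"
      using ell2_pointwise_le x by fastforce
    moreover have "?g F x = (if x \<in> A then w x else 0)" using F val[of F x] by auto
    ultimately show "norm (f x - (if x \<in> A then w x else 0)) \<le> ell2_norm V (\<lambda>x. f x - ?g F x)"
      by simp
  qed auto
  then have "norm (f x - (if x \<in> A then w x else 0)) \<le> 0"
    using s unfolding ell2_has_sum_def
    by (intro tendsto_lowerbound[where F = "finite_subsets_at_top A"]) auto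
  then show ?thesis by simp
qed

lemma shift_unique:
  assumes M: "discrete_measure_space M" and T: "T \<in> space M \<rightarrow> space M"
    and h: "esssup M (h_fun M T) < \<infinity>"
  shows "\<exists>!S. is_shift M T S"
    and "f \<in> ell2 (space M) \<Longrightarrow> shift M T f = shift_formula M T f"
proof -
  let ?V = "space M"
  let ?S = "\<lambda>f. if f \<in> ell2 ?V then shift_formula M T f else (\<lambda>_. 0)"
  have b: "bounded_op ?V (shift_formula M T)" by (rule shift_formula_bounded_op[OF M T h])
  have bS: "bounded_op ?V ?S"
  proof -
    have "(\<lambda>x. f x + g x) \<in> ell2 ?V" if f: "f \<in> ell2 ?V" and g: "g \<in> ell2 ?V" for f g
    proof -
      have "(\<lambda>x. 2 * (cmod (f x))\<^sup>2 + 2 * (cmod (g x))\<^sup>2) summable_on ?V"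
        using f g by (intro summable_on_add summable_on_cmult_right) (auto simp: ell2_def)
      then have "(\<lambda>x. (cmod (f x + g x))\<^sup>2) summable_on ?V"
      proof (rule summable_on_comparison_test)
        fix x
        have "(cmod (f x + g x))\<^sup>2 \<le> (cmod (f x) + cmod (g x))\<^sup>2"
          by (intro power_mono norm_triangle_ineq) auto
        also have "\<dots> \<le> 2 * (cmod (f x))\<^sup>2 + 2 * (cmod (g x))\<^sup>2"
          using zero_le_power2[of "cmod (f x) - cmod (g x)"] by (simp add: power2_eq_square algebra_simps)
        finally show "(cmod (f x + g x))\<^sup>2 \<le> 2 * (cmod (f x))\<^sup>2 + 2 * (cmod (g x))\<^sup>2" .
      qed auto
      then show ?thesis using f g by (simp add: ell2_def)
    qed
    moreover have "(\<lambda>x. c * f x) \<in> ell2 ?V" if f: "f \<in> ell2 ?V" for f c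
      using f by (auto simp: ell2_def norm_mult power_mult_distrib intro!: summable_on_cmult_right)
    ultimately show ?thesis using b unfolding bounded_op_def by simp
  qed
  have ex: "is_shift M T ?S"
    using bS shift_formula_basis[OF M T h] by (auto simp: is_shift_def ell2_basis_in)
  have uniq: "S f = ?S f" if S: "is_shift M T S" for S f
  proof (cases "f \<in> ell2 ?V")
    case True
    have bop: "bounded_op ?V S" using S by (simp add: is_shift_def)
    have "S (ell2_basis u) = ?S (ell2_basis u)" if u: "u \<in> ?V" for u
    proof
      fix x
      have m: "S (ell2_basis u) \<in> ell2 ?V" by (rule bounded_opD(1)[OF bop ell2_basis_in[OF u]])
      show "S (ell2_basis u) x = ?S (ell2_basis u) x"
      proof (cases "x \<in> ?V")
        case True
        have "S (ell2_basis u) x = (if x \<in> {v \<in> ?V. T v = u} then complex_of_real (weight M T x) else 0)"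
          using S u m True by (intro ell2_has_sum_basis_value) (auto simp: is_shift_def)
        then show ?thesis using True ell2_basis_in[OF u]
          by (simp add: shift_formula_def) (simp add: ell2_basis_def)
      next
        case False
        then show ?thesis using m by (simp add: ell2_def shift_formula_def)
      qed
    qed
    then show ?thesis using bounded_op_determined[OF bop bS _ True] by blast
  next
    case False
    then show ?thesis using S by (simp add: is_shift_def)
  qed
  show e1: "\<exists>!S. is_shift M T S" using ex uniq by (intro ex1I[of _ ?S]) blast+
  moreover have "is_shift M T (shift M T)"
    unfolding shift_def by (rule theI'[OF e1])
  ultimately show "shift M T f = shift_formula M T f" if "f \<in> ell2 ?V"
    using uniq that by simp
qed

end

theory Submission
  imports Defs
begin

text \<open>
  Write \<open>N u n\<close> for the squared norm of the \<open>n\<close>-th iterate of the shift at the basis vector of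
  \<open>u\<close>; it is the mass of the \<open>n\<close>-fold preimage of \<open>u\<close> divided by the mass of \<open>u\<close>.  The operator
  \<open>S*\<^sup>k S\<^sup>k\<close> is diagonal with entries \<open>N u k\<close>, so \<open>S\<close> is \<open>m\<close>-isometric iff the \<open>m\<close>-th differences
  of all the sequences \<open>N u\<close> vanish, i.e. iff all \<open>N u\<close> are polynomials of degree at most \<open>m - 1\<close>.

  Going once around the cycle gives \<open>N (v 0) (n + \<kappa>) - N (v 0) n = q n\<close>, where \<open>q\<close> collects the
  nonnegative contributions of the branches.  If \<open>N (v 0)\<close> has degree at most \<open>m - 1\<close>, then \<open>q\<close> has
  degree at most \<open>m - 2\<close> and dominates, up to a constant factor and translations of the argument,
  every \<open>N u\<close> with \<open>u\<close> off the cycle, which gives the moment condition.  Conversely, under the moment condition the only question is whether \<open>N (v 0)\<close> is a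
  polynomial: the system \<open>A c = b\<close> says that the polynomial \<open>p\<close> with coefficients \<open>c\<close> satisfies
  \<open>p (x + \<kappa>) - p x = q x\<close> and \<open>p 0 = 1\<close>.  As \<open>A\<close> is triangular and nonsingular, there is exactly one
  such \<open>p\<close>, and \<open>B c = a\<close> says that it agrees with \<open>N (v 0)\<close> at \<open>1, \<dots>, \<kappa> - 1\<close>, hence everywhere.
\<close>

section \<open>Ranks and linear systems\<close>

text \<open>The trivial kernel makes the columns of \<open>A\<close> independent, so
  \<open>A\<close> has rank \<open>k\<close>; a further column keeps the rank exactly when it lies
  in their span, that is, when it is a value of \<open>A\<close>.\<close>

lemma (in vec_space) rank_append_col:
  assumes A: "A \<in> carrier_mat n k" and D: "D \<in> carrier_mat n l" "cols D = cols A @ [w]"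
    and inj: "\<And>x. x \<in> carrier_vec k \<Longrightarrow> A *\<^sub>v x = 0\<^sub>v n \<Longrightarrow> x = 0\<^sub>v k"
  shows "rank D = k \<longleftrightarrow> (\<exists>x\<in>carrier_vec k. A *\<^sub>v x = w)"
proof -
  let ?U = "set (cols A)"
  \<comment> \<open>Independence is a property of the set of columns, so repetitions have to be
    excluded first: equal columns \<open>i\<close> and \<open>j\<close> would put the difference of
    two unit vectors into the kernel.\<close>
  have dist: "distinct (cols A)"
  proof (rule ccontr)
    assume "\<not> distinct (cols A)"
    then obtain i j where ij: "i \<noteq> j" "i < k" "j < k" "col A i = col A j"
      using A by (auto simp: distinct_conv_nth)
    let ?x = "unit_vec k i - unit_vec k j :: 'a vec"
    have "A *\<^sub>v ?x = A *\<^sub>v unit_vec k i - A *\<^sub>v unit_vec k j"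
      using A by (intro mult_minus_distrib_mat_vec) auto
    also have "\<dots> = col A i - col A j"
    proof -
      have "A *\<^sub>v unit_vec k l = col A l" if "l < k" for l
        using A that by (intro eq_vecI) auto
      then show ?thesis using ij by simp
    qed
    also have "\<dots> = 0\<^sub>v n" using A ij by auto
    finally have "?x = 0\<^sub>v k" using inj by simp
    then have "?x $ i = 0" using ij by simp
    then show False using ij by simp
  qed
  have ind: "lin_indpt ?U" using lin_depE[OF A _ dist] inj by blast
  have U: "?U \<subseteq> carrier_vec n" using A cols_dim by blast
  have cardU: "card ?U = k" using distinct_card[OF dist] A by simp
  have setD: "set (cols D) = insert w ?U" using D(2) by simp
  have w: "w \<in> carrier_vec n" using setD D(1) cols_dim by blast
  have rA: "rank A = k" by (rule lin_indpt_full_rank[OF A dist ind])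
  have "w \<in> span ?U \<longleftrightarrow> (\<exists>x\<in>carrier_vec k. A *\<^sub>v x = w)"
  proof
    assume "w \<in> span ?U"
    then obtain a where "w = lincomb a ?U" using U finite_span by auto
    then show "\<exists>x\<in>carrier_vec k. A *\<^sub>v x = w"
      using mat_mult_eq_lincomb[OF A dist, of a] by (intro bexI[of _ "vec k (\<lambda>i. a (col A i))"]) auto
  next
    assume "\<exists>x\<in>carrier_vec k. A *\<^sub>v x = w"
    then obtain x where "x \<in> carrier_vec k" "A *\<^sub>v x = w" by blast
    then have "w = lincomb (\<lambda>a. x $ find_first a (cols A)) ?U"
      using lincomb_eq_mat_mult[OF A _ dist] by simp
    then show "w \<in> span ?U" using U finite_span by auto
  qed
  moreover have "rank D = k" if "w \<in> span ?U"
    using already_in_span[OF U that] rA unfolding rank_def setD by simp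
  moreover have "rank D \<noteq> k" if "w \<notin> span ?U"
  proof -
    have nU: "w \<notin> ?U" using that U in_own_span by blast
    then have "lin_indpt (insert w ?U)" using lin_dep_iff_in_span[OF U ind w nU] that by simp
    then have "card (insert w ?U) \<le> rank D" using rank_ge_card_indpt[OF D(1)] setD by simp
    then show ?thesis using nU cardU by simp
  qed
  ultimately show ?thesis by blast
qed

lemma nonsing_solution_ex1:
  assumes A: "A \<in> carrier_mat n n" and det: "det A \<noteq> (0 :: 'a :: field)" and b: "b \<in> carrier_vec n"
  shows "\<exists>!x. x \<in> carrier_vec n \<and> A *\<^sub>v x = b"
proof -
  obtain B where B: "B \<in> carrier_mat n n" "B * A = 1\<^sub>m n" "A * B = 1\<^sub>m n"
    using det_non_zero_imp_unit[OF A det, of "()"] by (auto simp: Units_def ring_mat_def)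
  show ?thesis
  proof (rule ex1I[of _ "B *\<^sub>v b"])
    have "A *\<^sub>v (B *\<^sub>v b) = (A * B) *\<^sub>v b" using A B(1) b by (rule assoc_mult_mat_vec[symmetric])
    then show "B *\<^sub>v b \<in> carrier_vec n \<and> A *\<^sub>v (B *\<^sub>v b) = b" using A B b by simp
  next
    fix x assume x: "x \<in> carrier_vec n \<and> A *\<^sub>v x = b"
    then have "B *\<^sub>v b = (B * A) *\<^sub>v x" using assoc_mult_mat_vec[OF B(1) A] by simp
    then show "x = B *\<^sub>v b" using B x by simp
  qed
qed

text \<open>\<open>A\<close> stacked on \<open>B\<close> has trivial kernel because \<open>A\<close>
  is nonsingular; the rank therefore stays \<open>n\<close> exactly when the last column,
  \<open>b\<close> stacked on \<open>a\<close>, is a value of this stack.\<close>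

lemma rank_four_block_append_col:
  fixes A B :: "'a :: field mat"
  assumes A: "A \<in> carrier_mat n n" and det: "det A \<noteq> 0" and B: "B \<in> carrier_mat l n"
    and a: "a \<in> carrier_vec l" and b: "b \<in> carrier_vec n"
  shows "vec_space.rank (n + l) (four_block_mat A (mat_of_cols n [b]) B (mat_of_cols l [a])) = n \<longleftrightarrow>
    (\<exists>x\<in>carrier_vec n. A *\<^sub>v x = b \<and> B *\<^sub>v x = a)"
proof -
  interpret vec_space "TYPE('a)" "n + l" .
  let ?D = "four_block_mat A (mat_of_cols n [b]) B (mat_of_cols l [a])"
  let ?C = "A @\<^sub>r B"
  have C: "?C \<in> carrier_mat (n + l) n" by (rule carrier_append_rows[OF A B])
  have D: "?D \<in> carrier_mat (n + l) (n + 1)" using A B by auto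
  have mult: "?C *\<^sub>v x = A *\<^sub>v x @\<^sub>v B *\<^sub>v x" if "x \<in> carrier_vec n" for x
    by (rule mat_mult_append[OF A B that])
  have inj: "x = 0\<^sub>v n" if x: "x \<in> carrier_vec n" "?C *\<^sub>v x = 0\<^sub>v (n + l)" for x
  proof -
    have "A *\<^sub>v x @\<^sub>v B *\<^sub>v x = 0\<^sub>v n @\<^sub>v 0\<^sub>v l" using x mult by auto
    then have "A *\<^sub>v x = 0\<^sub>v n" using append_vec_eq[OF mult_mat_vec_carrier[OF A x(1)] zero_carrier_vec] by simp
    then show ?thesis using det_0_iff_vec_prod_zero_field[OF A] det x(1) by blast
  qed
  have cols: "cols ?D = cols ?C @ [b @\<^sub>v a]"
  proof (rule nth_equalityI)
    show "length (cols ?D) = length (cols ?C @ [b @\<^sub>v a])" using A C D by simp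
    fix i assume "i < length (cols ?D)"
    then have i: "i < n + 1" using A by simp
    show "cols ?D ! i = (cols ?C @ [b @\<^sub>v a]) ! i"
    proof (rule eq_vecI)
      fix r assume "r < dim_vec ((cols ?C @ [b @\<^sub>v a]) ! i)"
      then have "r < n + l" using i A C a b by (auto simp: nth_append split: if_splits)
      then show "cols ?D ! i $ r = (cols ?C @ [b @\<^sub>v a]) ! i $ r"
        using i A B C D a b
        by (auto simp: nth_append append_rows_def mat_of_cols_def not_less less_Suc_eq)
    qed (use i A C D a b in \<open>auto simp: nth_append\<close>)
  qed
  have "rank ?D = n \<longleftrightarrow> (\<exists>x\<in>carrier_vec n. ?C *\<^sub>v x = b @\<^sub>v a)"
    by (rule rank_append_col[OF C D cols inj])
  also have "\<dots> \<longleftrightarrow> (\<exists>x\<in>carrier_vec n. A *\<^sub>v x = b \<and> B *\<^sub>v x = a)"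
    using mult A b by (intro bex_cong refl) (simp, subst append_vec_eq[of _ n], auto)
  finally show ?thesis .
qed

section \<open>Difference equations for polynomials\<close>

text \<open>A nonzero difference would have only finitely many roots.\<close>

lemma poly_eqI_nat:
  fixes p q :: "real poly"
  assumes "\<And>n. poly p (real n) = poly q (real n)"
  shows "p = q"
proof (rule ccontr)
  assume "p \<noteq> q"
  then have "finite {x. poly (p - q) x = 0}" by (intro poly_roots_finite) simp
  moreover have "range real \<subseteq> {x. poly (p - q) x = 0}" using assms by auto
  ultimately have "finite (range real)" by (rule rev_finite_subset)
  then show False by (simp add: finite_image_iff inj_on_def)
qed

text \<open>
  The coefficients of \<open>p (x + k) - p x\<close>, for \<open>degree p \<le> n\<close>, in the form in which they occur in the
  rows of \<open>A_mat\<close>.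
\<close>

definition shift_diff_poly :: "nat \<Rightarrow> real \<Rightarrow> real poly \<Rightarrow> real poly" where
  "shift_diff_poly n k p =
     (\<Sum>t<n. monom (\<Sum>j=Suc t..n. poly.coeff p j * real (j choose t) * k ^ (j - t)) t)"

lemma coeff_shift_diff_poly:
  "poly.coeff (shift_diff_poly n k p) t =
    (if t < n then \<Sum>j=Suc t..n. poly.coeff p j * real (j choose t) * k ^ (j - t) else 0)"
  by (simp add: shift_diff_poly_def coeff_sum sum.delta)

text \<open>In the binomial expansion of the \<open>j\<close>-th power of \<open>x + k\<close> the
  term \<open>t = j\<close> cancels; collecting the remaining terms by powers of \<open>x\<close>
  gives the coefficients.\<close>

lemma poly_shift_diff_poly:
  assumes "degree p \<le> n"
  shows "poly (shift_diff_poly n k p) x = poly p (x + k) - poly p x"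
proof -
  have alt: "poly p y = (\<Sum>j\<le>n. poly.coeff p j * y ^ j)" for y
    unfolding poly_altdef using assms
    by (intro sum.mono_neutral_left) (auto simp: coeff_eq_0)
  have pow: "(x + k) ^ j - x ^ j = (\<Sum>t<j. real (j choose t) * x ^ t * k ^ (j - t))" for j
  proof -
    have "(x + k) ^ j = (\<Sum>t\<le>j. real (j choose t) * x ^ t * k ^ (j - t))"
      by (rule binomial_ring)
    then show ?thesis by (simp add: lessThan_Suc_atMost[symmetric])
  qed
  have "poly p (x + k) - poly p x = (\<Sum>j\<le>n. poly.coeff p j * ((x + k) ^ j - x ^ j))"
    by (simp add: alt sum_subtractf right_diff_distrib)
  also have "\<dots> = (\<Sum>j\<le>n. \<Sum>t<j. poly.coeff p j * real (j choose t) * k ^ (j - t) * x ^ t)"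
    by (simp add: pow sum_distrib_left mult_ac)
  also have "\<dots> = (\<Sum>t<n. \<Sum>j=Suc t..n. poly.coeff p j * real (j choose t) * k ^ (j - t) * x ^ t)"
    by (rule sum.nested_swap')
  also have "\<dots> = poly (shift_diff_poly n k p) x"
    by (simp add: shift_diff_poly_def poly_sum poly_monom sum_distrib_right)
  finally show ?thesis by simp
qed

lemma degree_shift_diff_poly: "degree (shift_diff_poly n k p) \<le> n - 1"
  by (rule degree_le) (auto simp: coeff_shift_diff_poly)

lemma coeff_poly_of_coeffs:
  "poly.coeff (poly_of_coeffs m c) j = (if j < m then vec_index c (m - 1 - j) else 0)"
  by (simp add: poly_of_coeffs_def coeff_sum sum.delta)

lemma degree_poly_of_coeffs: "degree (poly_of_coeffs m c) \<le> m - 1"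
  by (rule degree_le) (auto simp: coeff_poly_of_coeffs)

lemma poly_of_coeffs_surj:
  assumes "degree p \<le> m - 1" "m \<ge> 1"
  shows "poly_of_coeffs m (Matrix.vec m (\<lambda>i. poly.coeff p (m - 1 - i))) = p"
proof (rule poly_eqI)
  fix j
  have "poly.coeff p j = 0" if "\<not> j < m" using that assms by (intro coeff_eq_0) auto
  then show "poly.coeff (poly_of_coeffs m (Matrix.vec m (\<lambda>i. poly.coeff p (m - 1 - i)))) j = poly.coeff p j"
    by (auto simp: coeff_poly_of_coeffs)
qed

section \<open>The difference equation as a triangular linear system\<close>

lemma A_mat_carrier: "A_mat m \<kappa> \<in> carrier_mat m m"
  by (simp add: A_mat_def)

text \<open>The matrix is lower triangular; numbered from 1, its diagonal entries are
  \<open>(m - i) * \<kappa>\<close> for \<open>i < m\<close>, followed by 1.\<close>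

lemma det_A_mat:
  assumes "\<kappa> \<ge> 1"
  shows "Determinant.det (A_mat m \<kappa>) \<noteq> 0"
proof -
  have "Determinant.det (A_mat m \<kappa>) = prod_list (diag_mat (A_mat m \<kappa>))"
    by (rule det_lower_triangular[OF _ A_mat_carrier]) (auto simp: A_mat_def Let_def)
  also have "\<dots> \<noteq> 0"
    unfolding prod_list_zero_iff using assms
    by (auto simp: diag_mat_def A_mat_def Let_def d_coeff_def in_set_conv_nth)
  finally show ?thesis .
qed

text \<open>Column \<open>i\<close> belongs to the power \<open>m - 1 - i\<close> of the polynomial,
  and row \<open>r < m - 1\<close> to the power \<open>m - 2 - r\<close> of its difference. The
  entry at \<open>(r, i)\<close> is the binomial contribution of the one to the other; the last row
  reads off the constant term.\<close>

lemma A_mat_mult_vec: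
  assumes c: "c \<in> carrier_vec m" and m: "m \<ge> 1"
  shows "A_mat m \<kappa> *\<^sub>v c = Matrix.vec m (\<lambda>r. if r = m - 1 then poly (poly_of_coeffs m c) 0
    else poly.coeff (shift_diff_poly (m - 1) (real \<kappa>) (poly_of_coeffs m c)) (m - 2 - r))"
proof (rule eq_vecI)
  let ?p = "poly_of_coeffs m c"
  fix r assume "r < dim_vec (Matrix.vec m (\<lambda>r. if r = m - 1 then poly ?p 0
    else poly.coeff (shift_diff_poly (m - 1) (real \<kappa>) ?p) (m - 2 - r)))"
  then have r: "r < m" by simp
  have lhs: "(A_mat m \<kappa> *\<^sub>v c) $ r = (\<Sum>i<m. A_mat m \<kappa> $$ (r, i) * vec_index c i)"
    using r c by (simp add: A_mat_def scalar_prod_def atLeast0LessThan)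
  show "(A_mat m \<kappa> *\<^sub>v c) $ r = Matrix.vec m (\<lambda>r. if r = m - 1 then poly ?p 0
    else poly.coeff (shift_diff_poly (m - 1) (real \<kappa>) ?p) (m - 2 - r)) $ r"
  proof (cases "r = m - 1")
    case True
    have "(\<Sum>i<m. A_mat m \<kappa> $$ (r, i) * vec_index c i)
        = (\<Sum>i<m. if i = m - 1 then vec_index c i else 0)"
      using True m by (intro sum.cong) (auto simp: A_mat_def Let_def)
    also have "\<dots> = poly ?p 0" using m by (simp add: poly_0_coeff_0 coeff_poly_of_coeffs)
    finally show ?thesis using lhs True r by simp
  next
    case False
    then have rm: "r < m - 1" using r by simp
    have "(\<Sum>i<m. A_mat m \<kappa> $$ (r, i) * vec_index c i)
        = (\<Sum>i\<le>r. A_mat m \<kappa> $$ (r, i) * vec_index c i)"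
      using rm by (intro sum.mono_neutral_right) (auto simp: A_mat_def Let_def)
    also have "\<dots> = (\<Sum>i\<le>r. real ((m - 1 - i) choose (m - 2 - r)) * real \<kappa> ^ (r + 1 - i) * vec_index c i)"
    proof (intro sum.cong refl)
      fix i assume "i \<in> {..r}"
      then have i: "i \<le> r" by simp
      \<comment> \<open>The lower index of the binomial coefficient depends on the row only: the
        terms with \<open>i\<close> cancel.\<close>
      then have e: "m - Suc (r - i) - Suc i = m - 2 - r" "Suc r - i = Suc (r - i)" using rm by auto
      show "A_mat m \<kappa> $$ (r, i) * vec_index c i
        = real ((m - 1 - i) choose (m - 2 - r)) * real \<kappa> ^ (r + 1 - i) * vec_index c i"
        using i rm e by (auto simp: A_mat_def Let_def d_coeff_def)
    qed
    also have "\<dots> = (\<Sum>j=Suc (m - 2 - r)..m - 1. poly.coeff ?p j * real (j choose (m - 2 - r)) *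
        real \<kappa> ^ (j - (m - 2 - r)))"
      using rm
      by (intro sum.reindex_bij_witness[of _ "\<lambda>j. m - 1 - j" "\<lambda>i. m - 1 - i"])
        (auto simp: coeff_poly_of_coeffs mult_ac Suc_diff_le intro!: arg_cong[where f = "\<lambda>e. _ ^ e"] arg_cong2[where f="(*)"])
    finally show ?thesis using lhs rm r by (simp add: coeff_shift_diff_poly)
  qed
qed (simp add: A_mat_def)

text \<open>The rows above the last one compare all coefficients up to degree \<open>m - 2\<close>,
  and neither side of the difference equation exceeds this degree. For \<open>m = 1\<close> the
  truncated \<open>m - 2\<close> would still admit a nonzero constant \<open>q\<close> that no row
  sees, hence the extra hypothesis.\<close>

lemma A_mat_system_iff:
  assumes c: "c \<in> carrier_vec m" and m: "m \<ge> 1" and q: "degree q \<le> m - 2" "m = 1 \<Longrightarrow> q = 0"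
  shows "A_mat m \<kappa> *\<^sub>v c = Matrix.vec m (\<lambda>r. if r = m - 1 then d else poly.coeff q (m - 2 - r)) \<longleftrightarrow>
    poly (poly_of_coeffs m c) 0 = d \<and>
    (\<forall>x. poly (poly_of_coeffs m c) (x + real \<kappa>) - poly (poly_of_coeffs m c) x = poly q x)"
proof -
  let ?p = "poly_of_coeffs m c" and ?D = "shift_diff_poly (m - 1) (real \<kappa>) (poly_of_coeffs m c)"
  have "A_mat m \<kappa> *\<^sub>v c = Matrix.vec m (\<lambda>r. if r = m - 1 then d else poly.coeff q (m - 2 - r)) \<longleftrightarrow>
    (\<forall>r<m. (if r = m - 1 then poly ?p 0 else poly.coeff ?D (m - 2 - r)) =
      (if r = m - 1 then d else poly.coeff q (m - 2 - r)))"
    unfolding A_mat_mult_vec[OF c m] by (auto simp: vec_eq_iff)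
  also have "\<dots> \<longleftrightarrow> poly ?p 0 = d \<and> (\<forall>r<m - 1. poly.coeff ?D (m - 2 - r) = poly.coeff q (m - 2 - r))"
    using m by (auto simp: less_diff_conv)
  also have "(\<forall>r<m - 1. poly.coeff ?D (m - 2 - r) = poly.coeff q (m - 2 - r)) \<longleftrightarrow> ?D = q"
  proof
    assume *: "\<forall>r<m - 1. poly.coeff ?D (m - 2 - r) = poly.coeff q (m - 2 - r)"
    show "?D = q"
    proof (rule poly_eqI)
      fix t
      show "poly.coeff ?D t = poly.coeff q t"
      proof (cases "t < m - 1")
        case True
        then have "m - 2 - t < m - 1" "m - 2 - (m - 2 - t) = t" by auto
        then show ?thesis using * by metis
      next
        case False
        then have "poly.coeff q t = 0" using q m by (cases "m = 1") (auto intro!: coeff_eq_0)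
        then show ?thesis using False by (simp add: coeff_shift_diff_poly)
      qed
    qed
  qed simp
  also have "?D = q \<longleftrightarrow> (\<forall>x. poly ?p (x + real \<kappa>) - poly ?p x = poly q x)"
    unfolding poly_shift_diff_poly[OF degree_poly_of_coeffs, symmetric]
    by (auto simp: fun_eq_iff poly_eq_poly_eq_iff[symmetric])
  finally show ?thesis .
qed

text \<open>Invertibility of \<open>A_mat\<close> replaces an explicit summation formula. The size
  \<open>n + 2\<close> makes \<open>m - 2\<close> equal to \<open>n\<close> and \<open>m - 1\<close>
  equal to \<open>Suc n\<close>.\<close>

lemma shift_diff_equation_solution:
  fixes q :: "real poly"
  assumes "degree q \<le> n" "\<kappa> \<ge> (1 :: nat)"
  obtains p where "degree p \<le> Suc n" "poly p 0 = d"
    "\<And>x. poly p (x + real \<kappa>) - poly p x = poly q x"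
proof -
  let ?m = "n + 2"
  let ?b = "Matrix.vec ?m (\<lambda>r. if r = ?m - 1 then d else poly.coeff q (?m - 2 - r))"
  have "\<exists>!c. c \<in> carrier_vec ?m \<and> A_mat ?m \<kappa> *\<^sub>v c = ?b"
    by (rule nonsing_solution_ex1[OF A_mat_carrier det_A_mat[OF assms(2)]]) simp
  then obtain c where c: "c \<in> carrier_vec ?m" "A_mat ?m \<kappa> *\<^sub>v c = ?b" by blast
  then show thesis
    using A_mat_system_iff[OF c(1), of q \<kappa> d] assms degree_poly_of_coeffs[of ?m c]
    by (intro that[of "poly_of_coeffs ?m c"]) auto
qed

section \<open>Finite differences of polynomial sequences\<close>

text \<open>The \<open>m\<close>-th forward difference. At \<open>n = 0\<close> and for the squared
  orbit norms of a vertex it is the diagonal entry of the operator sum in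
  \<open>m_isometric\<close>.\<close>

definition alt_diff :: "nat \<Rightarrow> (nat \<Rightarrow> real) \<Rightarrow> nat \<Rightarrow> real" where
  "alt_diff m g n = (\<Sum>k\<le>m. (- 1) ^ (m - k) * real (m choose k) * g (n + k))"

text \<open>Pascal's rule splits the coefficients of order \<open>Suc m\<close> into two sums of
  order \<open>m\<close>.\<close>

lemma alt_diff_Suc: "alt_diff (Suc m) g = alt_diff m (\<lambda>n. g (Suc n) - g n)"
proof
  fix n
  have "alt_diff (Suc m) g n = (- 1) ^ Suc m * g n +
      (\<Sum>k\<le>m. (- 1) ^ (m - k) * (real (m choose k) + real (m choose Suc k)) * g (n + Suc k))"
    unfolding alt_diff_def by (subst sum.atMost_Suc_shift) (simp del: sum.atMost_Suc)
  also have "\<dots> = (\<Sum>k\<le>m. (- 1) ^ (m - k) * real (m choose k) * g (n + Suc k)) +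
      ((- 1) ^ Suc m * g n + (\<Sum>k\<le>m. (- 1) ^ (m - k) * real (m choose Suc k) * g (n + Suc k)))"
    by (simp add: algebra_simps sum.distrib)
  \<comment> \<open>The isolated term becomes the summand \<open>k = 0\<close>; the new last summand
    vanishes because \<open>m choose Suc m\<close> is 0.\<close>
  also have "(- 1) ^ Suc m * g n + (\<Sum>k\<le>m. (- 1) ^ (m - k) * real (m choose Suc k) * g (n + Suc k))
      = (\<Sum>k\<le>Suc m. (- 1) ^ (Suc m - k) * real (m choose k) * g (n + k))"
    by (simp add: sum.atMost_Suc_shift del: sum.atMost_Suc)
  also have "\<dots> = - (\<Sum>k\<le>m. (- 1) ^ (m - k) * real (m choose k) * g (n + k))"
    by (auto simp: Suc_diff_le sum_negf[symmetric] intro!: sum.cong)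
  finally show "alt_diff (Suc m) g n = alt_diff m (\<lambda>n. g (Suc n) - g n) n"
    by (simp add: alt_diff_def right_diff_distrib sum_subtractf)
qed

text \<open>Induction on the order: taking increments lowers the degree by one, and conversely a
  polynomial with given polynomial increments and given value at 0 exists by the difference equation
  with period 1.\<close>

lemma alt_diff_Suc_eq_0_iff:
  "(\<forall>n. alt_diff (Suc m) g n = 0) \<longleftrightarrow> (\<exists>p. degree p \<le> m \<and> (\<forall>n. poly p (real n) = g n))"
proof (induction m arbitrary: g)
  case 0
  have "(\<forall>n. alt_diff (Suc 0) g n = 0) \<longleftrightarrow> (\<forall>n. g (Suc n) = g n)"
    by (simp add: alt_diff_def)
  also have "\<dots> \<longleftrightarrow> (\<forall>n. g n = g 0)"
  proof
    assume *: "\<forall>n. g (Suc n) = g n"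
    have "g n = g 0" for n by (induction n) (simp_all add: *)
    then show "\<forall>n. g n = g 0" by blast
  qed metis
  also have "\<dots> \<longleftrightarrow> (\<exists>p. degree p \<le> 0 \<and> (\<forall>n. poly p (real n) = g n))"
  proof
    assume "\<forall>n. g n = g 0"
    then have "degree [:g 0:] \<le> 0 \<and> (\<forall>n. poly [:g 0:] (real n) = g n)" by (metis degree_pCons_0 order_refl mult_zero_right poly_pCons poly_0 add_0_right)
    then show "\<exists>p. degree p \<le> 0 \<and> (\<forall>n. poly p (real n) = g n)" by blast
  next
    assume "\<exists>p. degree p \<le> 0 \<and> (\<forall>n. poly p (real n) = g n)"
    then obtain p where p: "degree p = 0" "\<And>n. poly p (real n) = g n" by auto
    then obtain a where "p = [:a:]" by (meson degree_eq_zeroE)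
    then show "\<forall>n. g n = g 0" using p(2)[symmetric] by simp
  qed
  finally show ?case .
next
  case (Suc m)
  have "(\<forall>n. alt_diff (Suc (Suc m)) g n = 0) \<longleftrightarrow>
      (\<exists>q. degree q \<le> m \<and> (\<forall>n. poly q (real n) = g (Suc n) - g n))"
    unfolding alt_diff_Suc[of "Suc m"] by (rule Suc.IH)
  also have "\<dots> \<longleftrightarrow> (\<exists>p. degree p \<le> Suc m \<and> (\<forall>n. poly p (real n) = g n))"
  proof
    assume "\<exists>q. degree q \<le> m \<and> (\<forall>n. poly q (real n) = g (Suc n) - g n)"
    then obtain q where q: "degree q \<le> m" "\<And>n. poly q (real n) = g (Suc n) - g n" by blast
    obtain p where p: "degree p \<le> Suc m" "poly p 0 = g 0" "\<And>x. poly p (x + real 1) - poly p x = poly q x"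
      using shift_diff_equation_solution[OF q(1), of 1] by auto
    have "poly p (real n) = g n" for n
    proof (induction n)
      case (Suc n)
      then show ?case using p(3)[of "real n"] q(2)[of n] by (simp add: add.commute)
    qed (simp add: p)
    then show "\<exists>p. degree p \<le> Suc m \<and> (\<forall>n. poly p (real n) = g n)" using p(1) by blast
  next
    assume "\<exists>p. degree p \<le> Suc m \<and> (\<forall>n. poly p (real n) = g n)"
    then obtain p where p: "degree p \<le> Suc m" "\<And>n. poly p (real n) = g n" by blast
    have "poly (shift_diff_poly (Suc m) 1 p) (real n) = g (Suc n) - g n" for n
      using p(2)[of n] p(2)[of "Suc n"] by (simp add: poly_shift_diff_poly[OF p(1)] add.commute)
    then show "\<exists>q. degree q \<le> m \<and> (\<forall>n. poly q (real n) = g (Suc n) - g n)"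
      using degree_shift_diff_poly[of "Suc m" 1 p] by auto
  qed
  finally show ?case .
qed

section \<open>Growth comparison, interpolation and infinite sums of polynomials\<close>

text \<open>If \<open>r\<close> had smaller degree, division by the power \<open>degree p\<close> of
  \<open>n\<close> would squeeze \<open>p\<close> between 0 and a null sequence, so its leading
  coefficient would vanish.\<close>

lemma degree_le_of_poly_le:
  fixes p r :: "real poly"
  assumes nonneg: "\<And>n. 0 \<le> poly p (real n)" and le: "\<And>n. poly p (real n) \<le> poly r (real n)"
  shows "degree p \<le> degree r"
proof (rule ccontr)
  assume "\<not> degree p \<le> degree r"
  then have d: "degree r < degree p" by simp
  have at: "filterlim (\<lambda>n. real n) at_infinity sequentially"
    by (rule tendsto_of_nat)
  have limp: "(\<lambda>n. poly p (real n) / real n ^ degree p) \<longlonglongrightarrow> lead_coeff p"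
    by (rule filterlim_compose[OF poly_divide_tendsto_aux at])
  have zero: "(0 :: real) ^ (degree p - degree r) = 0" using d by (intro zero_power) simp
  have "(\<lambda>n. poly r (real n) / real n ^ degree r * (1 / real n) ^ (degree p - degree r))
      \<longlonglongrightarrow> lead_coeff r * 0 ^ (degree p - degree r)"
    by (intro tendsto_mult tendsto_power lim_1_over_n filterlim_compose[OF poly_divide_tendsto_aux at])
  note limr = this[unfolded zero mult_zero_right]
  have "(\<lambda>n. poly p (real n) / real n ^ degree p) \<longlonglongrightarrow> 0"
  proof (rule tendsto_sandwich[OF _ _ tendsto_const limr])
    show "\<forall>\<^sub>F n in sequentially. 0 \<le> poly p (real n) / real n ^ degree p"
      using nonneg by simp
    \<comment> \<open>This includes \<open>n = 0\<close>, where division by 0 makes both sides 0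
      because \<open>degree p\<close> is positive.\<close>
    have "poly p (real n) / real n ^ degree p
        \<le> poly r (real n) / real n ^ degree r * (1 / real n) ^ (degree p - degree r)" for n
    proof -
      have "real n ^ degree p = real n ^ degree r * real n ^ (degree p - degree r)"
        using d by (simp add: power_add[symmetric])
      then show ?thesis using le[of n] by (simp add: power_one_over divide_right_mono)
    qed
    then show "\<forall>\<^sub>F n in sequentially. poly p (real n) / real n ^ degree p
        \<le> poly r (real n) / real n ^ degree r * (1 / real n) ^ (degree p - degree r)" by simp
  qed
  then have "lead_coeff p = 0" using limp LIMSEQ_unique by blast
  then show False using d by simp
qed

text \<open>Lagrange polynomials for the nodes 0 to \<open>d\<close>: both sides of the expansion
  have degree at most \<open>d\<close> and agree at \<open>d + 1\<close> points. The
  \<open>L j\<close> do not depend on \<open>p\<close>, so whole families of polynomials can be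
  expanded at once.\<close>

lemma lagrange_interpolation_basis:
  obtains L :: "nat \<Rightarrow> real poly" where
    "\<And>p. degree p \<le> d \<Longrightarrow> p = (\<Sum>j\<le>d. Polynomial.smult (poly p (real j)) (L j))"
    "\<And>j. j \<le> d \<Longrightarrow> degree (L j) \<le> d"
proof -
  define L :: "nat \<Rightarrow> real poly" where
    "L j = (\<Prod>i\<in>{..d} - {j}. Polynomial.smult (1 / (real j - real i)) [:- real i, 1:])" for j
  have val: "poly (L j) (real k) = (if k = j then 1 else 0)" if "k \<le> d" for j k
  proof (cases "k = j")
    case True
    then show ?thesis by (auto simp: L_def poly_prod divide_simps intro!: prod.neutral)
  next
    case False
    then have "poly (Polynomial.smult (1 / (real j - real k)) [:- real k, 1:]) (real k) = 0" by simp
    then show ?thesis using False that by (auto simp: L_def poly_prod intro!: prod_zero bexI[of _ k])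
  qed
  have deg: "degree (L j) \<le> d" if "j \<le> d" for j
  proof -
    have "degree (L j) \<le> (\<Sum>i\<in>{..d} - {j}. degree (Polynomial.smult (1 / (real j - real i)) [:- real i, 1:]))"
      unfolding L_def by (rule degree_prod_sum_le[unfolded comp_def]) simp
    also have "\<dots> \<le> (\<Sum>i\<in>{..d} - {j}. 1)" by (intro sum_mono) (auto intro: order.trans[OF degree_smult_le])
    also have "\<dots> = d" using that by simp
    finally show ?thesis .
  qed
  have "p = (\<Sum>j\<le>d. Polynomial.smult (poly p (real j)) (L j))" if "degree p \<le> d" for p
  proof (rule poly_eqI_degree[where A = "real ` {..d}"])
    have card: "card (real ` {..d}) = Suc d" by (subst card_image) auto
    show "card (real ` {..d}) > degree p" using card that by simp
    have "degree (\<Sum>j\<le>d. Polynomial.smult (poly p (real j)) (L j)) \<le> d"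
      using deg by (intro degree_sum_le) (auto intro: order.trans[OF degree_smult_le])
    then show "card (real ` {..d}) > degree (\<Sum>j\<le>d. Polynomial.smult (poly p (real j)) (L j))"
      using card by simp
    fix x assume "x \<in> real ` {..d}"
    then obtain k where k: "x = real k" "k \<le> d" by auto
    then have "poly (\<Sum>j\<le>d. Polynomial.smult (poly p (real j)) (L j)) x
        = (\<Sum>j\<le>d. if k = j then poly p (real j) else 0)"
      unfolding poly_sum by (intro sum.cong) (auto simp: val)
    then show "poly p x = poly (\<Sum>j\<le>d. Polynomial.smult (poly p (real j)) (L j)) x" using k by simp
  qed
  then show thesis using deg that by blast
qed

lemma has_sum_sum:
  fixes f :: "'i \<Rightarrow> 'b \<Rightarrow> 'c :: topological_comm_monoid_add"
  assumes "\<And>i. i \<in> I \<Longrightarrow> (f i has_sum s i) A"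
  shows "((\<lambda>x. \<Sum>i\<in>I. f i x) has_sum (\<Sum>i\<in>I. s i)) A"
proof (cases "finite I")
  case True
  then show ?thesis using assms by (induction I) (auto intro: has_sum_add has_sum_0)
qed (auto intro: has_sum_0)

text \<open>The value at a real \<open>x\<close> is a fixed finite combination of the values at 0 to
  \<open>d\<close>. Summability at natural arguments thus passes to every real argument, and the sum
  is a combination of the same \<open>L j\<close>.\<close>

lemma has_sum_poly_of_nat_summable:
  fixes p :: "'b \<Rightarrow> real poly"
  assumes deg: "\<And>y. y \<in> B \<Longrightarrow> degree (p y) \<le> d"
    and sm: "\<And>n. (\<lambda>y. poly (p y) (real n)) summable_on B"
  obtains Q where "degree Q \<le> d" "\<And>x. ((\<lambda>y. poly (p y) x) has_sum poly Q x) B"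
proof -
  obtain L where L: "\<And>p. degree p \<le> d \<Longrightarrow> p = (\<Sum>j\<le>d. Polynomial.smult (poly p (real j)) (L j))"
    "\<And>j. j \<le> d \<Longrightarrow> degree (L j) \<le> d"
    using lagrange_interpolation_basis[of d] by blast
  define Q where "Q = (\<Sum>j\<le>d. Polynomial.smult (\<Sum>\<^sub>\<infinity>y\<in>B. poly (p y) (real j)) (L j))"
  show thesis
  proof (rule that[of Q])
    show "degree Q \<le> d" unfolding Q_def
      using L(2) by (intro degree_sum_le) (auto intro: order.trans[OF degree_smult_le])
    fix x
    have "((\<lambda>y. \<Sum>j\<le>d. poly (p y) (real j) * poly (L j) x) has_sum
        (\<Sum>j\<le>d. (\<Sum>\<^sub>\<infinity>y\<in>B. poly (p y) (real j)) * poly (L j) x)) B"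
      by (intro has_sum_sum has_sum_cmult_left) (use sm in auto)
    moreover have "(\<Sum>j\<le>d. poly (p y) (real j) * poly (L j) x) = poly (p y) x" if "y \<in> B" for y
      using arg_cong[OF L(1)[OF deg[OF that]], of "\<lambda>q. poly q x"] by (simp add: poly_sum)
    ultimately have "((\<lambda>y. poly (p y) x) has_sum (\<Sum>j\<le>d. (\<Sum>\<^sub>\<infinity>y\<in>B. poly (p y) (real j)) * poly (L j) x)) B"
      by (simp cong: has_sum_cong)
    then show "((\<lambda>y. poly (p y) x) has_sum poly Q x) B" by (simp add: Q_def poly_sum)
  qed
qed

section \<open>The rank condition as solvability of a linear system\<close>

lemma B_mat_carrier: "B_mat m \<kappa> \<in> carrier_mat (\<kappa> - 1) m"
  by (simp add: B_mat_def)

lemma B_mat_mult_vec: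
  assumes c: "c \<in> carrier_vec m"
  shows "B_mat m \<kappa> *\<^sub>v c = Matrix.vec (\<kappa> - 1) (\<lambda>l. poly (poly_of_coeffs m c) (real (l + 1)))"
proof (rule eq_vecI)
  fix l assume "l < dim_vec (Matrix.vec (\<kappa> - 1) (\<lambda>l. poly (poly_of_coeffs m c) (real (l + 1))))"
  then have l: "l < \<kappa> - 1" by simp
  have "(B_mat m \<kappa> *\<^sub>v c) $ l = (\<Sum>i<m. real (l + 1) ^ (m - 1 - i) * vec_index c i)"
    using l c by (simp add: B_mat_def scalar_prod_def atLeast0LessThan)
  also have "\<dots> = (\<Sum>j<m. vec_index c (m - 1 - j) * real (l + 1) ^ j)"
    by (intro sum.reindex_bij_witness[of _ "\<lambda>j. m - 1 - j" "\<lambda>i. m - 1 - i"]) auto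
  also have "\<dots> = poly (poly_of_coeffs m c) (real (l + 1))"
    by (simp add: poly_of_coeffs_def poly_sum poly_monom)
  finally show "(B_mat m \<kappa> *\<^sub>v c) $ l
      = Matrix.vec (\<kappa> - 1) (\<lambda>l. poly (poly_of_coeffs m c) (real (l + 1))) $ l"
    using l by simp
qed (simp add: B_mat_def)

text \<open>Both ranks express solvability: the system for \<open>A_tilde\<close> is solvable
  because \<open>A_mat\<close> is nonsingular, and the one for \<open>B_tilde\<close> asks a
  solution to satisfy the rows of \<open>B_mat\<close> as well.\<close>

lemma rank_condition_iff:
  assumes "\<kappa> \<ge> 1"
  shows "rank_condition M T m \<kappa> v \<R> \<longleftrightarrow>
    (\<exists>c\<in>carrier_vec m. A_mat m \<kappa> *\<^sub>v c = b_vec M T m \<kappa> v \<R> \<and> B_mat m \<kappa> *\<^sub>v c = a_vec M T \<kappa> v)"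
proof -
  let ?b = "b_vec M T m \<kappa> v \<R>" and ?A = "A_mat m \<kappa>"
  note A = A_mat_carrier[of m \<kappa>]
  have b: "?b \<in> carrier_vec m" by (simp add: b_vec_def)
  have a: "a_vec M T \<kappa> v \<in> carrier_vec (\<kappa> - 1)" by (simp add: a_vec_def)
  interpret vec_space "TYPE(real)" m .
  have cols: "set (cols ?A) \<subseteq> carrier_vec m" using cols_dim[of ?A] carrier_matD(1)[OF A] by simp
  have "rank (A_tilde M T m \<kappa> v \<R>) = m \<longleftrightarrow> (\<exists>x\<in>carrier_vec m. ?A *\<^sub>v x = ?b)"
  proof (rule rank_append_col[OF A])
    show "A_tilde M T m \<kappa> v \<R> \<in> carrier_mat m (Suc m)"
      using mat_of_cols_carrier(1)[of m "cols ?A @ [?b]"] carrier_matD(2)[OF A] by (simp add: A_tilde_def)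
    show "cols (A_tilde M T m \<kappa> v \<R>) = cols ?A @ [?b]"
      unfolding A_tilde_def using cols b by (intro cols_mat_of_cols) auto
    show "\<And>x. x \<in> carrier_vec m \<Longrightarrow> ?A *\<^sub>v x = 0\<^sub>v m \<Longrightarrow> x = 0\<^sub>v m"
      using det_0_iff_vec_prod_zero_field[OF A] det_A_mat[OF assms] by blast
  qed
  moreover have "\<exists>x\<in>carrier_vec m. ?A *\<^sub>v x = ?b"
    using nonsing_solution_ex1[OF A det_A_mat[OF assms] b] by blast
  moreover have "vec_space.rank (m + (\<kappa> - 1)) (B_tilde M T m \<kappa> v \<R>) = m \<longleftrightarrow>
      (\<exists>x\<in>carrier_vec m. ?A *\<^sub>v x = ?b \<and> B_mat m \<kappa> *\<^sub>v x = a_vec M T \<kappa> v)"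
    unfolding B_tilde_def by (rule rank_four_block_append_col[OF A det_A_mat[OF assms] B_mat_carrier a b])
  ultimately show ?thesis unfolding rank_condition_def by (simp add: eq_commute[of m])
qed

text \<open>Induction in steps of \<open>\<kappa>\<close>: equal increments propagate the agreement
  on the first \<open>\<kappa>\<close> arguments.\<close>

lemma poly_eq_of_shift_diff_eq:
  fixes f :: "nat \<Rightarrow> real"
  assumes "\<kappa> \<ge> 1" and diff: "\<And>n. poly p (real n + real \<kappa>) - poly p (real n) = f (n + \<kappa>) - f n"
    and init: "\<And>n. n < \<kappa> \<Longrightarrow> poly p (real n) = f n"
  shows "poly p (real n) = f n"
proof (induction n rule: less_induct)
  case (less n)
  show ?case
  proof (cases "n < \<kappa>")
    case False
    then have "n - \<kappa> < n" "real (n - \<kappa>) + real \<kappa> = real n" "n - \<kappa> + \<kappa> = n" using assms(1) by auto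
    then show ?thesis using less[of "n - \<kappa>"] diff[of "n - \<kappa>"] by simp
  qed (rule init)
qed

section \<open>Moments of the shift\<close>

text \<open>The points \<open>x\<close> of \<open>S\<close> are reindexed by the pairs
  \<open>(h x, x)\<close>, and the inner sum over each fibre is taken first.\<close>

lemma has_sum_fibres:
  fixes f :: "'b \<Rightarrow> 'c :: {topological_comm_monoid_add, t3_space}"
  assumes "(f has_sum s) S" and h: "\<And>x. x \<in> S \<Longrightarrow> h x \<in> B"
    and fib: "\<And>b. b \<in> B \<Longrightarrow> (f has_sum g b) {x \<in> S. h x = b}"
  shows "(g has_sum s) B"
proof -
  let ?P = "Sigma B (\<lambda>b. {x \<in> S. h x = b})"
  have "((\<lambda>p. f (snd p)) has_sum s) ?P \<longleftrightarrow> (f has_sum s) S"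
    by (rule has_sum_reindex_bij_witness[of _ "\<lambda>x. (h x, x)" snd]) (auto simp: h)
  then have "((\<lambda>p. f (snd p)) has_sum s) ?P" using assms(1) by simp
  then show ?thesis by (rule has_sum_SigmaD) (use fib in simp)
qed

text \<open>The product is dominated by the sum of the two squares.\<close>

lemma ell2_prod_summable:
  assumes "f \<in> ell2 V" "g \<in> ell2 V"
  shows "(\<lambda>x. f x * cnj (g x)) summable_on V"
proof (rule abs_summable_summable)
  have "(\<lambda>x. (cmod (f x))\<^sup>2 + (cmod (g x))\<^sup>2) summable_on V"
    using assms by (intro summable_on_add) (auto simp: ell2_def)
  then show "(\<lambda>x. cmod (f x * cnj (g x))) summable_on V"
  proof (rule summable_on_comparison_test)
    fix x
    have "0 \<le> (cmod (f x) - cmod (g x))\<^sup>2" "0 \<le> cmod (f x) * cmod (g x)" by simp_all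
    then show "cmod (f x * cnj (g x)) \<le> (cmod (f x))\<^sup>2 + (cmod (g x))\<^sup>2"
      unfolding norm_mult complex_mod_cnj power2_diff by linarith
  qed simp
qed

lemma ell2_scale:
  assumes "f \<in> ell2 V"
  shows "(\<lambda>x. c * f x) \<in> ell2 V"
  using assms by (auto simp: ell2_def norm_mult power_mult_distrib intro!: summable_on_cmult_right)

locale bounded_shift =
  fixes M :: "'a measure" and T :: "'a \<Rightarrow> 'a"
  assumes dms: "discrete_measure_space M"
    and T_maps: "T \<in> space M \<rightarrow> space M"
    and bounded: "esssup M (h_fun M T) < \<infinity>"
begin

abbreviation "X \<equiv> space M"
abbreviation "\<mu> x \<equiv> measure M {x}"
abbreviation "N \<equiv> orbit_norm2 M T"
abbreviation "S \<equiv> shift M T"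

lemma mu_pos: "x \<in> X \<Longrightarrow> \<mu> x > 0"
  using dms by (auto simp: discrete_measure_space_def measure_def enn2real_positive_iff)

lemma T_in: "x \<in> X \<Longrightarrow> T x \<in> X"
  using T_maps by auto

lemma funpow_T_in: "x \<in> X \<Longrightarrow> (T ^^ n) x \<in> X"
  by (induction n) (auto simp: T_in)

lemma shift_bounded_op: "bounded_op X S"
proof -
  have "is_shift M T S"
    unfolding shift_def by (rule theI'[OF shift_unique(1)[OF dms T_maps bounded]])
  then show ?thesis by (simp add: is_shift_def)
qed

lemma shift_in_ell2: "f \<in> ell2 X \<Longrightarrow> S f \<in> ell2 X"
  using shift_bounded_op by (rule bounded_opD(1))

lemma shift_apply:
  "f \<in> ell2 X \<Longrightarrow> S f = (\<lambda>x. if x \<in> X then of_real (weight M T x) * f (T x) else 0)"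
  by (simp add: shift_unique(2)[OF dms T_maps bounded] shift_formula_def)

lemma shift_funpow_in_ell2: "f \<in> ell2 X \<Longrightarrow> (S ^^ n) f \<in> ell2 X"
  by (induction n) (auto simp: shift_in_ell2)

section \<open>Iterates of the shift and masses of preimages\<close>

text \<open>The weights telescope along the orbit of \<open>x\<close>; only the masses of its two
  end points remain.\<close>

lemma shift_funpow_apply:
  assumes f: "f \<in> ell2 X"
  shows "(S ^^ n) f =
    (\<lambda>x. if x \<in> X then of_real (sqrt (\<mu> x / \<mu> ((T ^^ n) x))) * f ((T ^^ n) x) else 0)"
proof (induction n)
  case 0
  have "\<mu> x \<noteq> 0" if "x \<in> X" for x using mu_pos[OF that] by simp
  then show ?case using f by (auto simp: ell2_def)
next
  case (Suc n)
  have "(S ^^ Suc n) f = S ((S ^^ n) f)" by simp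
  also have "\<dots> = (\<lambda>x. if x \<in> X then of_real (weight M T x) * (S ^^ n) f (T x) else 0)"
    by (rule shift_apply[OF shift_funpow_in_ell2[OF f]])
  also have "\<dots> = (\<lambda>x. if x \<in> X then of_real (sqrt (\<mu> x / \<mu> ((T ^^ Suc n) x))) * f ((T ^^ Suc n) x) else 0)"
  proof
    fix x
    show "(if x \<in> X then of_real (weight M T x) * (S ^^ n) f (T x) else 0) =
      (if x \<in> X then of_real (sqrt (\<mu> x / \<mu> ((T ^^ Suc n) x))) * f ((T ^^ Suc n) x) else 0)"
    proof (cases "x \<in> X")
      case True
      have "\<mu> (T x) > 0" using True by (simp add: T_in mu_pos)
      then have "weight M T x * sqrt (\<mu> (T x) / \<mu> ((T ^^ n) (T x))) = sqrt (\<mu> x / \<mu> ((T ^^ n) (T x)))"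
        by (simp add: weight_def real_sqrt_divide)
      moreover have "(T ^^ n) (T x) = (T ^^ Suc n) x" by (simp add: funpow_swap1)
      ultimately show ?thesis using True T_in[OF True]
        by (simp add: Suc.IH mult.assoc[symmetric] of_real_mult[symmetric] del: of_real_mult)
    qed simp
  qed
  finally show ?case .
qed

lemma N_has_sum:
  assumes u: "u \<in> X"
  shows "((\<lambda>x. \<mu> x / \<mu> u) has_sum N u n) {x \<in> X. (T ^^ n) x = u}"
proof -
  let ?f = "(S ^^ n) (ell2_basis u)"
  have "?f \<in> ell2 X" by (rule shift_funpow_in_ell2[OF ell2_basis_in[OF u]])
  then have sm: "(\<lambda>x. (cmod (?f x))\<^sup>2) summable_on X" by (simp add: ell2_def)
  have "N u n = (\<Sum>\<^sub>\<infinity>x\<in>X. (cmod (?f x))\<^sup>2)"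
    by (simp add: orbit_norm2_def ell2_norm_def infsum_nonneg)
  then have "((\<lambda>x. (cmod (?f x))\<^sup>2) has_sum N u n) X" using sm by simp
  also have "?this \<longleftrightarrow> ((\<lambda>x. \<mu> x / \<mu> u) has_sum N u n) {x \<in> X. (T ^^ n) x = u}"
    unfolding shift_funpow_apply[OF ell2_basis_in[OF u]]
    by (rule has_sum_cong_neutral) (auto simp: ell2_basis_def)
  finally show ?thesis .
qed

lemma N_nonneg: "N u n \<ge> 0"
  by (simp add: orbit_norm2_def)

lemma N_0: "u \<in> X \<Longrightarrow> N u 0 = 1"
proof -
  assume u: "u \<in> X"
  have "{x \<in> X. (T ^^ 0) x = u} = {u}" using u by auto
  then have "((\<lambda>x. \<mu> x / \<mu> u) has_sum N u 0) {u}" using N_has_sum[OF u, of 0] by simp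
  then show ?thesis using mu_pos[OF u] has_sum_finite[of "{u}" "\<lambda>x. \<mu> x / \<mu> u"] has_sum_unique
    by fastforce
qed

text \<open>Masses of preimages add up without weights, so the recursions along the map are stated
  for \<open>\<mu> u * N u n\<close>.\<close>

lemma mass_has_sum:
  assumes u: "u \<in> X"
  shows "(\<mu> has_sum (\<mu> u * N u n)) {x \<in> X. (T ^^ n) x = u}"
  using has_sum_cmult_right[OF N_has_sum[OF u], of "\<mu> u"] mu_pos[OF u] by simp

text \<open>The points that reach \<open>u\<close> after \<open>Suc n\<close> steps are sorted by
  their position after \<open>n\<close> steps, which is a preimage of \<open>u\<close>.\<close>

lemma mass_Suc_has_sum:
  assumes u: "u \<in> X"
  shows "((\<lambda>y. \<mu> y * N y n) has_sum (\<mu> u * N u (Suc n))) {y \<in> X. T y = u}"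
proof (rule has_sum_fibres[OF mass_has_sum[OF u], where h = "T ^^ n"])
  fix y assume y: "y \<in> {y \<in> X. T y = u}"
  then have "{x \<in> {x \<in> X. (T ^^ Suc n) x = u}. (T ^^ n) x = y} = {x \<in> X. (T ^^ n) x = y}" by auto
  then show "(\<mu> has_sum \<mu> y * N y n) {x \<in> {x \<in> X. (T ^^ Suc n) x = u}. (T ^^ n) x = y}"
    using mass_has_sum[of y n] y by simp
qed (auto simp: funpow_T_in)

lemma weight_squared: "(weight M T x)\<^sup>2 = \<mu> x / \<mu> (T x)"
  by (simp add: weight_def power_divide)

lemma N_Suc_has_sum:
  assumes u: "u \<in> X"
  shows "((\<lambda>y. (weight M T y)\<^sup>2 * N y n) has_sum N u (Suc n)) {y \<in> X. T y = u}"
proof -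
  have "((\<lambda>y. inverse (\<mu> u) * (\<mu> y * N y n)) has_sum inverse (\<mu> u) * (\<mu> u * N u (Suc n))) {y \<in> X. T y = u}"
    by (rule has_sum_cmult_right[OF mass_Suc_has_sum[OF u]])
  also have "inverse (\<mu> u) * (\<mu> u * N u (Suc n)) = N u (Suc n)"
    using mu_pos[OF u] by simp
  also have "((\<lambda>y. inverse (\<mu> u) * (\<mu> y * N y n)) has_sum N u (Suc n)) {y \<in> X. T y = u} \<longleftrightarrow> ?thesis"
    by (rule has_sum_cong) (auto simp: weight_squared field_simps)
  finally show ?thesis .
qed

text \<open>A bound uniform in \<open>u\<close> makes multiplication by \<open>N u n\<close> an
  operation on \<open>ell2\<close>, as required for computing adjoints.\<close>

lemma N_bounded:
  obtains C where "C \<ge> 0" "\<And>u. u \<in> X \<Longrightarrow> N u n \<le> C"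
proof -
  obtain C where C: "\<And>f. f \<in> ell2 X \<Longrightarrow> ell2_norm X (S f) \<le> C * ell2_norm X f"
    using shift_bounded_op unfolding bounded_op_def by blast
  have nn: "ell2_norm X f \<ge> 0" for f by (simp add: ell2_norm_def infsum_nonneg)
  \<comment> \<open>The constant supplied by \<open>bounded_op\<close> carries no sign, hence the
    absolute value.\<close>
  have *: "ell2_norm X ((S ^^ k) f) \<le> \<bar>C\<bar> ^ k * ell2_norm X f" if f: "f \<in> ell2 X" for f k
  proof (induction k)
    case (Suc k)
    have "ell2_norm X ((S ^^ Suc k) f) \<le> C * ell2_norm X ((S ^^ k) f)"
      using C[OF shift_funpow_in_ell2[OF f]] by simp
    also have "\<dots> \<le> \<bar>C\<bar> * ell2_norm X ((S ^^ k) f)" using nn by (simp add: mult_right_mono)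
    also have "\<dots> \<le> \<bar>C\<bar> * (\<bar>C\<bar> ^ k * ell2_norm X f)" using Suc.IH by (simp add: mult_left_mono)
    finally show ?case by (simp add: mult.assoc)
  qed simp
  have "N u n \<le> (\<bar>C\<bar> ^ n)\<^sup>2" if u: "u \<in> X" for u
  proof -
    have "ell2_norm X (ell2_basis u) = sqrt (N u 0)" using nn by (simp add: orbit_norm2_def)
    then have "ell2_norm X (ell2_basis u) = 1" using N_0[OF u] by simp
    then have "ell2_norm X ((S ^^ n) (ell2_basis u)) \<le> \<bar>C\<bar> ^ n"
      using *[OF ell2_basis_in[OF u], of n] by simp
    then show ?thesis unfolding orbit_norm2_def using nn by (intro power_mono)
  qed
  then show thesis using that[of "(\<bar>C\<bar> ^ n)\<^sup>2"] by simp
qed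

section \<open>The adjoint and the criterion for \<open>m\<close>-isometries\<close>

lemma ell2_inner_basis: "u \<in> X \<Longrightarrow> ell2_inner X (ell2_basis u) g = cnj (g u)"
proof -
  assume u: "u \<in> X"
  have "ell2_inner X (ell2_basis u) g = (\<Sum>\<^sub>\<infinity>x\<in>{u}. cnj (g u))"
    unfolding ell2_inner_def using u by (intro infsum_cong_neutral) (auto simp: ell2_basis_def)
  then show ?thesis by simp
qed

text \<open>
  The adjoint is only needed on vectors of the form \<open>d \<cdot> S g\<close>, where its value can be written down;
  its existence on the whole space plays no role.
\<close>

lemma adjoint_shift_diag:
  assumes g: "g \<in> ell2 X" and d: "\<And>v. v \<in> X \<Longrightarrow> \<bar>d v\<bar> \<le> D" and e: "\<And>u. u \<in> X \<Longrightarrow> \<bar>e u\<bar> \<le> E"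
    and fib: "\<And>u. u \<in> X \<Longrightarrow> ((\<lambda>v. (weight M T v)\<^sup>2 * d v) has_sum e u) {v \<in> X. T v = u}"
  shows "ell2_adjoint X S (\<lambda>v. of_real (d v) * S g v) = (\<lambda>u. of_real (e u) * g u)"
proof -
  let ?h = "\<lambda>u. of_real (e u) * g u"
  have diag: "(\<lambda>v. of_real (c v) * k v) \<in> ell2 X"
    if k: "k \<in> ell2 X" and c: "\<And>v. v \<in> X \<Longrightarrow> \<bar>c v\<bar> \<le> C" for c :: "'a \<Rightarrow> real" and k C
  proof (rule ell2_cong_le[OF ell2_scale[OF k, of "of_real C"]])
    fix v assume "v \<in> X"
    then show "cmod (of_real (c v) * k v) \<le> cmod (of_real C * k v)"
      using c[of v] by (simp add: norm_mult mult_right_mono)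
  qed (use k in \<open>simp add: ell2_def\<close>)
  have h: "?h \<in> ell2 X" by (rule diag[OF g e])
  have inner: "ell2_inner X (S f) (\<lambda>v. of_real (d v) * S g v) = ell2_inner X f ?h"
    if f: "f \<in> ell2 X" for f
  proof -
    let ?F = "\<lambda>v. S f v * cnj (of_real (d v) * S g v)"
    have "?F summable_on X"
      by (intro ell2_prod_summable shift_in_ell2 f diag[OF shift_in_ell2[OF g] d])
    then have "(?F has_sum ell2_inner X (S f) (\<lambda>v. of_real (d v) * S g v)) X"
      by (simp add: ell2_inner_def)
    \<comment> \<open>On the fibre over \<open>u\<close> the values of \<open>f\<close> and
      \<open>g\<close> at \<open>T v\<close> are constant, so each fibre sum is a multiple of the
      sum of weights \<open>e u\<close>.\<close>
    then have "((\<lambda>u. f u * cnj (?h u)) has_sum ell2_inner X (S f) (\<lambda>v. of_real (d v) * S g v)) X"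
    proof (rule has_sum_fibres[where h = T])
      fix u assume u: "u \<in> X"
      have "((\<lambda>v. of_real ((weight M T v)\<^sup>2 * d v) * (f u * cnj (g u))) has_sum
          of_real (e u) * (f u * cnj (g u))) {v \<in> X. T v = u}"
        by (intro has_sum_cmult_left has_sum_of_real fib[OF u])
      also have "of_real (e u) * (f u * cnj (g u)) = f u * cnj (?h u)" by simp
      also have "((\<lambda>v. of_real ((weight M T v)\<^sup>2 * d v) * (f u * cnj (g u))) has_sum f u * cnj (?h u))
          {v \<in> X. T v = u} \<longleftrightarrow> (?F has_sum f u * cnj (?h u)) {x \<in> X. T x = u}"
        by (rule has_sum_cong)
          (auto simp: shift_apply[OF f] shift_apply[OF g] power2_eq_square mult_ac)
      finally show "(?F has_sum f u * cnj (?h u)) {x \<in> X. T x = u}" .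
    qed (rule T_in)
    then show ?thesis unfolding ell2_inner_def[of X f] by (simp add: infsumI)
  qed
  show ?thesis unfolding ell2_adjoint_def
  proof (rule the_equality)
    show "?h \<in> ell2 X \<and> (\<forall>f\<in>ell2 X. ell2_inner X (S f) (\<lambda>v. of_real (d v) * S g v) = ell2_inner X f ?h)"
      using h inner by blast
    fix k assume k: "k \<in> ell2 X \<and>
      (\<forall>f\<in>ell2 X. ell2_inner X (S f) (\<lambda>v. of_real (d v) * S g v) = ell2_inner X f k)"
    \<comment> \<open>Testing against basis vectors determines the entries in \<open>X\<close>;
      outside \<open>X\<close> both functions vanish.\<close>
    show "k = ?h"
    proof
      fix u
      show "k u = ?h u"
      proof (cases "u \<in> X")
        case True
        have "ell2_inner X (ell2_basis u) k = ell2_inner X (ell2_basis u) ?h"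
          using k inner ell2_basis_in[OF True] by metis
        then have "cnj (k u) = cnj (?h u)" unfolding ell2_inner_basis[OF True] .
        then show ?thesis by (simp only: complex_cnj_cancel_iff)
      next
        case False
        then show ?thesis using k h by (simp add: ell2_def)
      qed
    qed
  qed
qed

text \<open>Separate exponents make the induction work: while \<open>j < k\<close>, at least one
  factor \<open>S\<close> is left, so \<open>adjoint_shift_diag\<close> applies. The case
  \<open>j = k\<close> gives multiplication by \<open>N x k\<close>.\<close>

lemma adjoint_funpow_shift_funpow:
  assumes f: "f \<in> ell2 X" and "j \<le> k"
  shows "(ell2_adjoint X S ^^ j) ((S ^^ k) f) = (\<lambda>x. of_real (N x j) * (S ^^ (k - j)) f x)"
  using assms(2)
proof (induction j)
  case 0
  show ?case
  proof
    fix x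
    show "(ell2_adjoint X S ^^ 0) ((S ^^ k) f) x = of_real (N x 0) * (S ^^ (k - 0)) f x"
      using N_0[of x] shift_funpow_in_ell2[OF f, of k] by (cases "x \<in> X") (auto simp: ell2_def)
  qed
next
  case (Suc j)
  obtain C D where C: "\<And>u. u \<in> X \<Longrightarrow> N u j \<le> C" and D: "\<And>u. u \<in> X \<Longrightarrow> N u (Suc j) \<le> D"
    using N_bounded[of j] N_bounded[of "Suc j"] by metis
  have "k - j = Suc (k - Suc j)" using Suc.prems by simp
  then have "(ell2_adjoint X S ^^ Suc j) ((S ^^ k) f)
      = ell2_adjoint X S (\<lambda>x. of_real (N x j) * S ((S ^^ (k - Suc j)) f) x)"
    using Suc by simp
  also have "\<dots> = (\<lambda>x. of_real (N x (Suc j)) * (S ^^ (k - Suc j)) f x)"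
    by (rule adjoint_shift_diag[OF shift_funpow_in_ell2[OF f], of _ C _ D])
      (use C D in \<open>auto simp: N_nonneg intro: N_Suc_has_sum\<close>)
  finally show ?case .
qed

text \<open>The operator sum is multiplication by the \<open>m\<close>-th differences at 0, and
  basis vectors isolate its entries.\<close>

lemma m_isometric_iff_alt_diff: "m_isometric X m S \<longleftrightarrow> (\<forall>u\<in>X. alt_diff m (N u) 0 = 0)"
proof -
  have sum: "(\<Sum>k\<le>m. (- 1) ^ (m - k) * of_nat (m choose k) * ((ell2_adjoint X S ^^ k) ((S ^^ k) f)) x)
      = of_real (alt_diff m (N x) 0) * f x" if "f \<in> ell2 X" for f x
    unfolding alt_diff_def of_real_sum sum_distrib_right
    by (intro sum.cong) (simp_all add: adjoint_funpow_shift_funpow[OF that])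
  have "m_isometric X m S \<longleftrightarrow> (\<forall>f\<in>ell2 X. \<forall>x\<in>X. of_real (alt_diff m (N x) 0) * f x = 0)"
    unfolding m_isometric_def using shift_bounded_op by (simp add: sum)
  also have "\<dots> \<longleftrightarrow> (\<forall>u\<in>X. alt_diff m (N u) 0 = 0)"
  proof (intro iffI ballI)
    fix u assume *: "\<forall>f\<in>ell2 X. \<forall>x\<in>X. complex_of_real (alt_diff m (N x) 0) * f x = 0" and u: "u \<in> X"
    have "complex_of_real (alt_diff m (N u) 0) * ell2_basis u u = 0"
      using * ell2_basis_in[OF u] u by blast
    then show "alt_diff m (N u) 0 = 0" by (simp add: ell2_basis_def)
  qed simp
  finally show ?thesis .
qed

text \<open>By \<open>N_Suc_has_sum\<close> the difference of \<open>N u\<close> at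
  \<open>Suc n\<close> is a weighted sum of the differences at \<open>n\<close> over the preimages
  of \<open>u\<close>, so vanishing at 0 for all vertices propagates.\<close>

lemma alt_diff_N_eq_0:
  assumes "\<forall>u\<in>X. alt_diff m (N u) 0 = 0"
  shows "u \<in> X \<Longrightarrow> alt_diff m (N u) n = 0"
proof (induction n arbitrary: u)
  case 0
  then show ?case using assms by blast
next
  case (Suc n)
  have "((\<lambda>y. \<Sum>k\<le>m. (- 1) ^ (m - k) * real (m choose k) * ((weight M T y)\<^sup>2 * N y (n + k))) has_sum
      (\<Sum>k\<le>m. (- 1) ^ (m - k) * real (m choose k) * N u (Suc (n + k)))) {y \<in> X. T y = u}"
    by (intro has_sum_sum has_sum_cmult_right N_Suc_has_sum Suc.prems)
  also have "(\<lambda>y. \<Sum>k\<le>m. (- 1) ^ (m - k) * real (m choose k) * ((weight M T y)\<^sup>2 * N y (n + k)))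
      = (\<lambda>y. (weight M T y)\<^sup>2 * alt_diff m (N y) n)"
    by (simp add: alt_diff_def sum_distrib_left mult_ac)
  also have "(\<Sum>k\<le>m. (- 1) ^ (m - k) * real (m choose k) * N u (Suc (n + k))) = alt_diff m (N u) (Suc n)"
    by (simp add: alt_diff_def)
  also have "((\<lambda>y. (weight M T y)\<^sup>2 * alt_diff m (N y) n) has_sum alt_diff m (N u) (Suc n)) {y \<in> X. T y = u}
      \<longleftrightarrow> ((\<lambda>y. 0) has_sum alt_diff m (N u) (Suc n)) {y \<in> X. T y = u}"
    by (rule has_sum_cong) (simp add: Suc.IH)
  finally show ?case using has_sum_0 has_sum_unique by metis
qed

lemma m_isometric_iff_poly:
  "m_isometric X (Suc m) S \<longleftrightarrow> (\<forall>u\<in>X. \<exists>p. degree p \<le> m \<and> (\<forall>n. poly p (real n) = N u n))"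
  unfolding m_isometric_iff_alt_diff alt_diff_Suc_eq_0_iff[symmetric]
  using alt_diff_N_eq_0[of "Suc m"] by blast

end

section \<open>Maps of one-cycle type\<close>

locale one_cycle_shift = bounded_shift M T
  for M :: "'a measure" and T :: "'a \<Rightarrow> 'a" +
  fixes \<kappa> :: nat and v :: "nat \<Rightarrow> 'a" and \<R> :: "'a set set"
  assumes conn: "Digraph_Component.connected (map_graph M T)"
    and one_cycle: "one_cycle_type_with (map_graph M T) \<kappa> v \<R>"
begin

abbreviation "G \<equiv> map_graph M T"
abbreviation "C \<equiv> v ` {..<\<kappa>}"

text \<open>The roots of the trees attached to \<open>v i\<close>, described through
  \<open>T\<close> alone; the link to \<open>\<R>\<close> is
  \<open>bij_betw_root_branches\<close>.\<close>

definition branches :: "nat \<Rightarrow> 'a set" where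
  "branches i = {y \<in> X - C. T y = v i}"

section \<open>The map on the cycle and on the trees\<close>

lemma dominates_map_graph_iff: "a \<rightarrow>\<^bsub>G\<^esub> b \<longleftrightarrow> b \<in> X \<and> a = T b"
  by (auto simp: map_graph_def)

lemma kappa_pos: "\<kappa> \<ge> 1"
  using one_cycle by (simp add: one_cycle_type_with_def)

lemma v_in: "i < \<kappa> \<Longrightarrow> v i \<in> X"
  using one_cycle by (auto simp: one_cycle_type_with_def map_graph_def)

lemma inj_v: "inj_on v {..<\<kappa>}"
  using one_cycle by (simp add: one_cycle_type_with_def)

lemma v_eq_iff: "i < \<kappa> \<Longrightarrow> j < \<kappa> \<Longrightarrow> v i = v j \<longleftrightarrow> i = j"
  using inj_v by (auto simp: inj_on_def)

lemma T_v_Suc: "Suc j < \<kappa> \<Longrightarrow> T (v (Suc j)) = v j"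
  using one_cycle by (auto simp: one_cycle_type_with_def dominates_map_graph_iff)

lemma T_v_0: "T (v 0) = v (\<kappa> - 1)"
  using one_cycle by (auto simp: one_cycle_type_with_def dominates_map_graph_iff)

lemma T_v_succ: "i < \<kappa> \<Longrightarrow> T (v (Suc i mod \<kappa>)) = v i"
proof -
  assume i: "i < \<kappa>"
  show ?thesis
  proof (cases "Suc i = \<kappa>")
    case True
    then have "\<kappa> - 1 = i" by simp
    then show ?thesis using True T_v_0 by simp
  next
    case False
    then show ?thesis using i T_v_Suc[of i] by simp
  qed
qed

text \<open>Arcs run from \<open>T y\<close> to \<open>y\<close>, so \<open>T\<close> rotates the
  cycle backwards. Hence exactly one preimage of \<open>v i\<close> is on the cycle, namely its
  successor, and this is \<open>v 0\<close> itself if \<open>\<kappa> = 1\<close>.\<close>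

lemma fibre_v:
  assumes i: "i < \<kappa>"
  shows "{y \<in> X. T y = v i} = insert (v (Suc i mod \<kappa>)) (branches i)"
    and "v (Suc i mod \<kappa>) \<notin> branches i"
proof -
  have succ: "Suc i mod \<kappa> < \<kappa>" using kappa_pos by simp
  show "v (Suc i mod \<kappa>) \<notin> branches i" using succ by (auto simp: branches_def)
  have "y = v (Suc i mod \<kappa>)" if y: "y \<in> C" "T y = v i" for y
  proof -
    obtain j where j: "j < \<kappa>" "y = v j" using y by auto
    show ?thesis
    proof (cases j)
      case 0
      then have "v (\<kappa> - 1) = v i" using y j T_v_0 by simp
      then have "\<kappa> - 1 = i" using v_eq_iff[of "\<kappa> - 1" i] i kappa_pos by simp
      then have "Suc i = \<kappa>" using kappa_pos by simp
      then show ?thesis using 0 j by simp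
    next
      case (Suc l)
      then have "v l = v i" using y j T_v_Suc by simp
      then have "l = i" using v_eq_iff[of l i] i j Suc by simp
      then show ?thesis using Suc j by simp
    qed
  qed
  then show "{y \<in> X. T y = v i} = insert (v (Suc i mod \<kappa>)) (branches i)"
    using i succ v_in T_v_succ by (auto simp: branches_def)
qed

lemma partition_R: "\<Union>\<R> = X - C" "R \<in> \<R> \<Longrightarrow> R' \<in> \<R> \<Longrightarrow> x \<in> R \<Longrightarrow> x \<in> R' \<Longrightarrow> R = R'"
proof -
  have p: "partition_on (X - C) \<R>"
    using one_cycle by (simp add: one_cycle_type_with_def map_graph_def)
  show "\<Union>\<R> = X - C" using p by (auto simp: partition_on_def)
  show "R \<in> \<R> \<Longrightarrow> R' \<in> \<R> \<Longrightarrow> x \<in> R \<Longrightarrow> x \<in> R' \<Longrightarrow> R = R'"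
    using p unfolding partition_on_def disjoint_def by blast
qed

text \<open>The only arc of the graph into \<open>y\<close> starts at \<open>T y\<close>, and it
  survives the restriction to \<open>R\<close> exactly when both ends lie in
  \<open>R\<close>.\<close>

lemma is_root_iff:
  assumes "R \<in> \<R>"
  shows "is_root (G \<restriction> R) y \<longleftrightarrow> y \<in> R \<and> T y \<notin> R"
proof -
  have "R \<subseteq> X" using partition_R(1) assms by auto
  then have "in_arcs (G \<restriction> R) y = (if y \<in> R \<and> T y \<in> R then {(T y, y)} else {})"
    by (auto simp: in_arcs_def map_graph_def)
  then show ?thesis by (auto simp: is_root_def in_degree_def)
qed

lemma root_of_R:
  assumes R: "R \<in> \<R>"
  shows "root_of (G \<restriction> R) \<in> R" "T (root_of (G \<restriction> R)) = v (branch_index G \<kappa> v R)"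
    "branch_index G \<kappa> v R < \<kappa>" "y \<in> R \<Longrightarrow> T y \<notin> R \<Longrightarrow> root_of (G \<restriction> R) = y"
proof -
  have ex1: "\<exists>!r. is_root (G \<restriction> R) r"
    using one_cycle R by (simp add: one_cycle_type_with_def rooted_directed_tree_def)
  have "is_root (G \<restriction> R) (root_of (G \<restriction> R))"
    unfolding root_of_def by (rule theI'[OF ex1])
  then show root: "root_of (G \<restriction> R) \<in> R" by (simp add: is_root_iff[OF R])
  show "root_of (G \<restriction> R) = y" if "y \<in> R" "T y \<notin> R"
    unfolding root_of_def using that is_root_iff[OF R] by (intro the1_equality[OF ex1]) simp
  have "\<exists>!i. i < \<kappa> \<and> v i \<rightarrow>\<^bsub>G\<^esub> root_of (G \<restriction> R)"
    using one_cycle R by (simp add: one_cycle_type_with_def)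
  from theI'[OF this] have "branch_index G \<kappa> v R < \<kappa> \<and> v (branch_index G \<kappa> v R) \<rightarrow>\<^bsub>G\<^esub> root_of (G \<restriction> R)"
    unfolding branch_index_def .
  then show "branch_index G \<kappa> v R < \<kappa>" "T (root_of (G \<restriction> R)) = v (branch_index G \<kappa> v R)"
    by (auto simp: dominates_map_graph_iff)
qed

text \<open>A vertex off the cycle whose image is on the cycle is the root of its tree, since no
  tree meets the cycle; disjointness of the trees gives injectivity.\<close>

lemma bij_betw_root_branches:
  assumes i: "i < \<kappa>"
  shows "bij_betw (\<lambda>R. root_of (G \<restriction> R)) {R \<in> \<R>. branch_index G \<kappa> v R = i} (branches i)"
proof (rule bij_betw_imageI)
  show "inj_on (\<lambda>R. root_of (G \<restriction> R)) {R \<in> \<R>. branch_index G \<kappa> v R = i}"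
  proof (rule inj_onI)
    fix R R' assume R: "R \<in> {R \<in> \<R>. branch_index G \<kappa> v R = i}"
      and R': "R' \<in> {R \<in> \<R>. branch_index G \<kappa> v R = i}"
      and eq: "root_of (G \<restriction> R) = root_of (G \<restriction> R')"
    have "root_of (G \<restriction> R) \<in> R" using R root_of_R(1) by blast
    moreover have "root_of (G \<restriction> R) \<in> R'" unfolding eq using R' root_of_R(1) by blast
    ultimately show "R = R'" using R R' by (intro partition_R(2)[of R R' "root_of (G \<restriction> R)"]) simp_all
  qed
  show "(\<lambda>R. root_of (G \<restriction> R)) ` {R \<in> \<R>. branch_index G \<kappa> v R = i} = branches i"
  proof
    show "(\<lambda>R. root_of (G \<restriction> R)) ` {R \<in> \<R>. branch_index G \<kappa> v R = i} \<subseteq> branches i"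
    proof (rule image_subsetI)
      fix R assume "R \<in> {R \<in> \<R>. branch_index G \<kappa> v R = i}"
      then have R: "R \<in> \<R>" "branch_index G \<kappa> v R = i" by simp_all
      have "root_of (G \<restriction> R) \<in> \<Union>\<R>" using R(1) root_of_R(1)[OF R(1)] by (rule UnionI)
      then show "root_of (G \<restriction> R) \<in> branches i"
        using root_of_R(2)[OF R(1)] R(2) by (simp add: branches_def partition_R(1))
    qed
    show "branches i \<subseteq> (\<lambda>R. root_of (G \<restriction> R)) ` {R \<in> \<R>. branch_index G \<kappa> v R = i}"
    proof
      fix y assume y: "y \<in> branches i"
      then have "y \<in> \<Union>\<R>" by (simp add: branches_def partition_R(1))
      then obtain R where R: "R \<in> \<R>" "y \<in> R" by blast
      have "T y \<in> C" using y i by (simp add: branches_def)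
      then have "T y \<notin> \<Union>\<R>" by (simp add: partition_R(1))
      then have "T y \<notin> R" using R(1) by blast
      then have root: "root_of (G \<restriction> R) = y" by (rule root_of_R(4)[OF R])
      then have "v (branch_index G \<kappa> v R) = v i"
        using root_of_R(2)[OF R(1)] y by (simp add: branches_def)
      then have "branch_index G \<kappa> v R = i" using v_eq_iff[OF root_of_R(3)[OF R(1)] i] by simp
      then show "y \<in> (\<lambda>R. root_of (G \<restriction> R)) ` {R \<in> \<R>. branch_index G \<kappa> v R = i}"
        using R root by blast
    qed
  qed
qed

text \<open>Reaching the cycle is a property that passes along every edge in both directions, so
  connectedness carries it from \<open>v 0\<close> to all vertices.\<close>

lemma funpow_T_in_C:
  assumes x: "x \<in> X"
  shows "\<exists>k. (T ^^ k) x \<in> C"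
proof -
  define W where "W x \<longleftrightarrow> (\<exists>k. (T ^^ k) x \<in> C)" for x
  have up: "W y" if W: "W (T y)" for y
  proof -
    obtain k where "(T ^^ k) (T y) \<in> C" using W unfolding W_def by (rule exE)
    then have "(T ^^ Suc k) y \<in> C" by (simp only: funpow_Suc_right comp_apply)
    then show ?thesis unfolding W_def by (rule exI)
  qed
  have T_C: "T y \<in> C" if "y \<in> C" for y
  proof -
    obtain j where j: "j < \<kappa>" "y = v j" using \<open>y \<in> C\<close> by auto
    show ?thesis
    proof (cases j)
      case 0
      then show ?thesis using j T_v_0 kappa_pos by simp
    next
      case (Suc l)
      then show ?thesis using j T_v_Suc[of l] by simp
    qed
  qed
  have down: "W (T y)" if W: "W y" for y
  proof -
    obtain k where "(T ^^ k) y \<in> C" using W unfolding W_def by (rule exE)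
    then have "(T ^^ k) (T y) \<in> C" unfolding funpow_swap1[symmetric] by (rule T_C)
    then show ?thesis unfolding W_def by (rule exI)
  qed
  have v0: "v 0 \<in> X" using v_in kappa_pos by simp
  have "v 0 \<rightarrow>\<^sup>*\<^bsub>with_proj (mk_symmetric G)\<^esub> x"
    using conn x v0 by (auto simp: Digraph_Component.connected_def strongly_connected_def map_graph_def)
  then have "(v 0, x) \<in> rtrancl_on (verts (with_proj (mk_symmetric G))) (arcs_ends (with_proj (mk_symmetric G)))"
    by (simp add: reachable_def)
  then have "W x"
  proof (induction rule: rtrancl_on_induct)
    case base
    have "(T ^^ 0) (v 0) \<in> C" using kappa_pos by auto
    then show ?case unfolding W_def by (rule exI)
  next
    case (step y z)
    then have "z = T y \<or> y = T z" by (auto simp: parcs_mk_symmetric map_graph_def)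
    then show ?case using step(5) up down by metis
  qed
  then show ?thesis by (simp add: W_def)
qed

text \<open>The required point is the last one of the orbit before its first visit to the
  cycle.\<close>

lemma funpow_T_in_branches:
  assumes x: "x \<in> X - C"
  obtains k i where "i < \<kappa>" "(T ^^ k) x \<in> branches i"
proof -
  have "\<exists>k. (T ^^ k) x \<in> C" using x by (intro funpow_T_in_C) simp
  then obtain k where k: "(T ^^ k) x \<in> C" and least: "\<And>l. l < k \<Longrightarrow> (T ^^ l) x \<notin> C"
    using exists_least_iff[of "\<lambda>k. (T ^^ k) x \<in> C"] by blast
  have "k \<noteq> 0" using k x by (intro notI) simp
  then obtain l where l: "k = Suc l" by (cases k) auto
  have "(T ^^ l) x \<notin> C" using least[of l] l by simp
  moreover obtain i where i: "i < \<kappa>" and "(T ^^ k) x = v i" using k by auto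
  ultimately have "(T ^^ l) x \<in> branches i" using x l by (simp add: branches_def funpow_T_in)
  then show thesis by (rule that[OF i])
qed

section \<open>Mass balance around the cycle\<close>

lemma branch_mass_summable:
  assumes i: "i < \<kappa>"
  shows "(\<lambda>y. \<mu> y * N y n) summable_on branches i"
proof -
  have "(\<lambda>y. \<mu> y * N y n) summable_on {y \<in> X. T y = v i}"
    using mass_Suc_has_sum[OF v_in[OF i]] by (rule has_sum_imp_summable)
  then show ?thesis by (rule summable_on_subset_banach) (auto simp: branches_def)
qed

text \<open>The mass of the points that reach \<open>v i\<close> in \<open>n + 1\<close> steps, the
  last of which enters the cycle from a tree.\<close>

definition branch_mass :: "nat \<Rightarrow> nat \<Rightarrow> real" where
  "branch_mass i n = (\<Sum>\<^sub>\<infinity>y\<in>branches i. \<mu> y * N y n)"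

lemma branch_mass_has_sum:
  "i < \<kappa> \<Longrightarrow> ((\<lambda>y. \<mu> y * N y n) has_sum branch_mass i n) (branches i)"
  by (simp add: branch_mass_def branch_mass_summable)

lemma branch_mass_nonneg: "branch_mass i n \<ge> 0"
  by (simp add: branch_mass_def infsum_nonneg N_nonneg)

definition cycle_mass :: "nat \<Rightarrow> nat \<Rightarrow> real" where
  "cycle_mass i n = \<mu> (v i) * N (v i) n"

lemma cycle_mass_Suc:
  assumes i: "i < \<kappa>"
  shows "cycle_mass i (Suc n) = cycle_mass (Suc i mod \<kappa>) n + branch_mass i n"
proof (rule has_sum_unique)
  show "((\<lambda>y. \<mu> y * N y n) has_sum cycle_mass i (Suc n)) {y \<in> X. T y = v i}"
    unfolding cycle_mass_def by (rule mass_Suc_has_sum[OF v_in[OF i]])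
  show "((\<lambda>y. \<mu> y * N y n) has_sum cycle_mass (Suc i mod \<kappa>) n + branch_mass i n) {y \<in> X. T y = v i}"
    unfolding fibre_v(1)[OF i] cycle_mass_def
    by (rule has_sum_insert[OF fibre_v(2)[OF i] branch_mass_has_sum[OF i]])
qed

text \<open>Iterating \<open>cycle_mass_Suc\<close> forward from \<open>v 0\<close>, each vertex
  \<open>v j\<close> passed contributes its branches with the number of steps then left. The
  reduction modulo \<open>\<kappa>\<close> takes effect only at \<open>i = \<kappa>\<close>.\<close>

lemma cycle_mass_add:
  assumes "i \<le> \<kappa>"
  shows "cycle_mass 0 (n + i) = cycle_mass (i mod \<kappa>) n + (\<Sum>j<i. branch_mass j (n + i - 1 - j))"
  using assms
proof (induction i arbitrary: n)
  case (Suc i)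
  then have i: "i < \<kappa>" by simp
  have "cycle_mass 0 (n + Suc i) = cycle_mass i (Suc n) + (\<Sum>j<i. branch_mass j (Suc n + i - 1 - j))"
    using Suc.IH[of "Suc n"] i by simp
  also have "cycle_mass i (Suc n) = cycle_mass (Suc i mod \<kappa>) n + branch_mass i n"
    by (rule cycle_mass_Suc[OF i])
  finally show ?case by simp
qed simp

text \<open>After \<open>\<kappa>\<close> steps the walk is back at \<open>v 0\<close>. The
  bracketing of the argument matches the translation by \<open>\<kappa> - i - 1\<close> in
  \<open>q\<close>.\<close>

lemma cycle_mass_period:
  "cycle_mass 0 (n + \<kappa>) - cycle_mass 0 n = (\<Sum>i<\<kappa>. branch_mass i (n + (\<kappa> - 1 - i)))"
proof -
  have eq: "n + \<kappa> - 1 - i = n + (\<kappa> - 1 - i)" if "i < \<kappa>" for i using that by simp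
  have "(\<Sum>i<\<kappa>. branch_mass i (n + \<kappa> - 1 - i)) = (\<Sum>i<\<kappa>. branch_mass i (n + (\<kappa> - 1 - i)))"
    by (intro sum.cong refl arg_cong[where f = "branch_mass _"] eq) simp
  then show ?thesis using cycle_mass_add[of \<kappa> n] by simp
qed

text \<open>The product telescopes, and for \<open>i < \<kappa>\<close> its indices do not wrap
  around.\<close>

lemma cycle_weight_squared:
  assumes "i < \<kappa>"
  shows "(cycle_weight M T \<kappa> v 0 i)\<^sup>2 = \<mu> (v i) / \<mu> (v 0)"
  using assms
proof (induction i)
  case 0
  then show ?case using mu_pos[OF v_in[of 0]] by (simp add: cycle_weight_def)
next
  case (Suc i)
  have "cycle_weight M T \<kappa> v 0 (Suc i) = cycle_weight M T \<kappa> v 0 i * weight M T (v (Suc i))"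
    using Suc.prems by (simp add: cycle_weight_def)
  then have "(cycle_weight M T \<kappa> v 0 (Suc i))\<^sup>2 = \<mu> (v i) / \<mu> (v 0) * (\<mu> (v (Suc i)) / \<mu> (v i))"
    using Suc T_v_Suc[OF Suc.prems] by (simp add: power_mult_distrib weight_squared)
  then show ?case using mu_pos[OF v_in[of i]] Suc.prems by simp
qed

section \<open>Moment polynomials and the polynomial \<open>q\<close>\<close>

lemma moment_poly_unique:
  assumes "is_moment_poly M T m x p"
  shows "\<exists>!p. is_moment_poly M T m x p" "moment_poly M T m x = p"
proof -
  have "p' = p" if "is_moment_poly M T m x p'" for p'
    using that assms by (intro poly_eqI_nat) (simp add: is_moment_poly_def)
  then show ex1: "\<exists>!p. is_moment_poly M T m x p" using assms by blast
  show "moment_poly M T m x = p" unfolding moment_poly_def by (rule the1_equality[OF ex1 assms])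
qed

lemma moment_polyD:
  assumes "moment_condition M T m \<kappa> v" "x \<in> X - C"
  shows "degree (moment_poly M T m x) \<le> m - 2" "poly (moment_poly M T m x) (real n) = N x n"
proof -
  have "\<exists>!p. is_moment_poly M T m x p" using assms unfolding moment_condition_def by (rule bspec)
  then have "is_moment_poly M T m x (moment_poly M T m x)" unfolding moment_poly_def by (rule theI')
  then show "degree (moment_poly M T m x) \<le> m - 2" "poly (moment_poly M T m x) (real n) = N x n"
    by (simp_all add: is_moment_poly_def)
qed

text \<open>Infinitely many trees may hang at \<open>v i\<close>. Their moment polynomials have a
  common degree bound and their weighted sums converge at natural arguments, where they are masses,
  so the sum is again a polynomial.\<close>

lemma branch_poly:
  assumes mc: "moment_condition M T m \<kappa> v" and i: "i < \<kappa>"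
  obtains Q where "degree Q \<le> m - 2" "\<And>n. poly Q (real n) = branch_mass i n"
    "\<And>x. ((\<lambda>y. \<mu> y * poly (moment_poly M T m y) x) has_sum poly Q x) (branches i)"
proof -
  let ?p = "\<lambda>y. Polynomial.smult (\<mu> y) (moment_poly M T m y)"
  have br: "y \<in> X - C" if "y \<in> branches i" for y using that by (simp add: branches_def)
  have val: "poly (?p y) (real n) = \<mu> y * N y n" if "y \<in> branches i" for y n
    using moment_polyD(2)[OF mc br[OF that]] by simp
  have deg: "degree (?p y) \<le> m - 2" if "y \<in> branches i" for y
    using moment_polyD(1)[OF mc br[OF that]] degree_smult_le order.trans by blast
  have sm: "(\<lambda>y. poly (?p y) (real n)) summable_on branches i" for n
    by (rule summable_on_cong[THEN iffD2, OF val branch_mass_summable[OF i]])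
  obtain Q where Q: "degree Q \<le> m - 2" "\<And>x. ((\<lambda>y. poly (?p y) x) has_sum poly Q x) (branches i)"
    using has_sum_poly_of_nat_summable[of "branches i" ?p "m - 2"] deg sm by blast
  have "poly Q (real n) = branch_mass i n" for n
  proof (rule has_sum_unique[OF Q(2)])
    show "((\<lambda>y. poly (?p y) (real n)) has_sum branch_mass i n) (branches i)"
      by (rule has_sum_cong[THEN iffD2, OF val branch_mass_has_sum[OF i]])
  qed
  then show thesis using Q by (intro that[of Q]) simp_all
qed

text \<open>The squared weights in front of a tree with root \<open>y\<close> multiply to
  \<open>\<mu> y / \<mu> (v 0)\<close>. Hence \<open>q\<close> is the sum of the translated branch
  polynomials divided by \<open>\<mu> (v 0)\<close>, and \<open>cycle_mass_period\<close> gives its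
  values.\<close>

lemma q_poly_exists:
  assumes mc: "moment_condition M T m \<kappa> v"
  obtains q where "is_q_poly M T m \<kappa> v \<R> q" "\<And>n. poly q (real n) = N (v 0) (n + \<kappa>) - N (v 0) n"
proof -
  have "\<exists>Q. degree Q \<le> m - 2 \<and> (\<forall>n. poly Q (real n) = branch_mass i n) \<and>
      (\<forall>x. ((\<lambda>y. \<mu> y * poly (moment_poly M T m y) x) has_sum poly Q x) (branches i))"
    if i: "i < \<kappa>" for i
    by (rule branch_poly[OF mc i]) blast
  then have "\<forall>i\<in>{..<\<kappa>}. \<exists>Q. degree Q \<le> m - 2 \<and> (\<forall>n. poly Q (real n) = branch_mass i n) \<and>
      (\<forall>x. ((\<lambda>y. \<mu> y * poly (moment_poly M T m y) x) has_sum poly Q x) (branches i))"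
    by simp
  from bchoice[OF this] obtain Q where "\<forall>i\<in>{..<\<kappa>}. degree (Q i) \<le> m - 2 \<and>
      (\<forall>n. poly (Q i) (real n) = branch_mass i n) \<and>
      (\<forall>x. ((\<lambda>y. \<mu> y * poly (moment_poly M T m y) x) has_sum poly (Q i) x) (branches i))"
    by (rule exE)
  then have deg: "\<And>i. i < \<kappa> \<Longrightarrow> degree (Q i) \<le> m - 2"
    and Q_nat: "\<And>i n. i < \<kappa> \<Longrightarrow> poly (Q i) (real n) = branch_mass i n"
    and Q_sum: "\<And>i x. i < \<kappa> \<Longrightarrow> ((\<lambda>y. \<mu> y * poly (moment_poly M T m y) x) has_sum poly (Q i) x) (branches i)"
    by simp_all
  have mu0: "\<mu> (v 0) > 0" using mu_pos v_in kappa_pos by simp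
  define q where "q = Polynomial.smult (1 / \<mu> (v 0))
    (\<Sum>i<\<kappa>. pcompose (Q i) [:real \<kappa> - real i - 1, 1:])"
  have q: "poly q x = (1 / \<mu> (v 0)) * (\<Sum>i<\<kappa>. poly (Q i) (x + real \<kappa> - real i - 1))" for x
    by (simp add: q_def poly_sum poly_pcompose algebra_simps)
  have "degree (\<Sum>i<\<kappa>. pcompose (Q i) [:real \<kappa> - real i - 1, 1:]) \<le> m - 2"
    using deg by (intro degree_sum_le) (auto simp: degree_pcompose)
  then have "degree q \<le> m - 2" unfolding q_def using degree_smult_le order.trans by blast
  moreover have "(t has_sum poly (Q i) (x + real \<kappa> - real i - 1) / \<mu> (v i)) {R \<in> \<R>. branch_index G \<kappa> v R = i}"
    if i: "i < \<kappa>" and t: "t = (\<lambda>R. (weight M T (root_of (G \<restriction> R)))\<^sup>2 *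
        poly (moment_poly M T m (root_of (G \<restriction> R))) (x + real \<kappa> - real i - 1))" for i x t
  proof -
    let ?f = "\<lambda>y. (weight M T y)\<^sup>2 * poly (moment_poly M T m y) (x + real \<kappa> - real i - 1)"
    have "((\<lambda>y. \<mu> y * poly (moment_poly M T m y) (x + real \<kappa> - real i - 1) * (1 / \<mu> (v i))) has_sum
        poly (Q i) (x + real \<kappa> - real i - 1) * (1 / \<mu> (v i))) (branches i)"
      by (rule has_sum_cmult_left[OF Q_sum[OF i]])
    also have "?this \<longleftrightarrow> (?f has_sum poly (Q i) (x + real \<kappa> - real i - 1) * (1 / \<mu> (v i))) (branches i)"
      by (rule has_sum_cong) (simp add: weight_squared branches_def)
    \<comment> \<open>The sum over attached vertices is reindexed by the trees that they are roots
      of.\<close>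
    also have "\<dots> \<longleftrightarrow> ((\<lambda>R. ?f (root_of (G \<restriction> R))) has_sum poly (Q i) (x + real \<kappa> - real i - 1) * (1 / \<mu> (v i)))
        {R \<in> \<R>. branch_index G \<kappa> v R = i}"
      by (rule has_sum_reindex_bij_betw[OF bij_betw_root_branches[OF i], symmetric])
    finally show ?thesis by (simp add: t)
  qed
  note terms = this[OF _ refl]
  have sum: "(\<Sum>i<\<kappa>. (cycle_weight M T \<kappa> v 0 i)\<^sup>2 * (\<Sum>\<^sub>\<infinity>R\<in>{R \<in> \<R>. branch_index G \<kappa> v R = i}.
      (weight M T (root_of (G \<restriction> R)))\<^sup>2 *
        poly (moment_poly M T m (root_of (G \<restriction> R))) (x + real \<kappa> - real i - 1))) = poly q x" for x
  proof -
    have "(cycle_weight M T \<kappa> v 0 i)\<^sup>2 * (\<Sum>\<^sub>\<infinity>R\<in>{R \<in> \<R>. branch_index G \<kappa> v R = i}.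
      (weight M T (root_of (G \<restriction> R)))\<^sup>2 *
        poly (moment_poly M T m (root_of (G \<restriction> R))) (x + real \<kappa> - real i - 1))
      = (1 / \<mu> (v 0)) * poly (Q i) (x + real \<kappa> - real i - 1)" if i: "i < \<kappa>" for i
      using infsumI[OF terms[OF i, of x]] cycle_weight_squared[OF i] mu_pos[OF v_in[OF i]] by simp
    then show ?thesis by (simp add: q sum_distrib_left)
  qed
  ultimately have "is_q_poly M T m \<kappa> v \<R> q"
    unfolding is_q_poly_def Let_def using has_sum_imp_summable[OF terms] by simp
  moreover have "poly q (real n) = N (v 0) (n + \<kappa>) - N (v 0) n" for n
  proof -
    have "poly (Q i) (real n + real \<kappa> - real i - 1) = branch_mass i (n + (\<kappa> - 1 - i))" if i: "i < \<kappa>" for i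
    proof -
      have "real n + real \<kappa> - real i - 1 = real (n + (\<kappa> - 1 - i))" using i by simp
      then show ?thesis using Q_nat[OF i] by metis
    qed
    then have "poly q (real n) = (1 / \<mu> (v 0)) * (cycle_mass 0 (n + \<kappa>) - cycle_mass 0 n)"
      unfolding q cycle_mass_period by simp
    then show ?thesis using mu0 by (simp add: cycle_mass_def diff_divide_distrib)
  qed
  ultimately show thesis by (rule that)
qed

lemma is_q_poly_unique: "is_q_poly M T m \<kappa> v \<R> q \<Longrightarrow> is_q_poly M T m \<kappa> v \<R> q' \<Longrightarrow> q = q'"
  unfolding is_q_poly_def Let_def by (intro poly_eq_poly_eq_iff[THEN iffD1] ext) metis

lemma q_polyD:
  assumes "moment_condition M T m \<kappa> v"
  shows "\<exists>!q. is_q_poly M T m \<kappa> v \<R> q" "degree (q_poly M T m \<kappa> v \<R>) \<le> m - 2"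
    "poly (q_poly M T m \<kappa> v \<R>) (real n) = N (v 0) (n + \<kappa>) - N (v 0) n"
proof -
  obtain q where q: "is_q_poly M T m \<kappa> v \<R> q" "\<And>n. poly q (real n) = N (v 0) (n + \<kappa>) - N (v 0) n"
    by (rule q_poly_exists[OF assms]) blast
  show ex1: "\<exists>!q. is_q_poly M T m \<kappa> v \<R> q" using q(1) is_q_poly_unique by blast
  have "q_poly M T m \<kappa> v \<R> = q" unfolding q_poly_def by (rule the1_equality[OF ex1 q(1)])
  then show "degree (q_poly M T m \<kappa> v \<R>) \<le> m - 2"
    "poly (q_poly M T m \<kappa> v \<R>) (real n) = N (v 0) (n + \<kappa>) - N (v 0) n"
    using q by (simp_all add: is_q_poly_def)
qed

section \<open>The moment condition and polynomial orbit norms\<close>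

text \<open>Every point that reaches \<open>u\<close> in \<open>n\<close> steps reaches the
  \<open>k\<close>-th iterate of \<open>u\<close> in \<open>n + k\<close> steps.\<close>

lemma mass_funpow_le:
  assumes u: "u \<in> X"
  shows "\<mu> u * N u n \<le> \<mu> ((T ^^ k) u) * N ((T ^^ k) u) (n + k)"
proof (rule has_sum_mono'[OF mass_has_sum[OF u] mass_has_sum[OF funpow_T_in[OF u]]])
  show "{x \<in> X. (T ^^ n) x = u} \<subseteq> {x \<in> X. (T ^^ (n + k)) x = (T ^^ k) u}"
    by (auto simp: funpow_add add.commute[of n])
qed simp

text \<open>
  The degree drops by one because the mass above \<open>u\<close> is dominated by the increment of the mass
  above \<open>v 0\<close> during one period, which is a difference of values of a polynomial.
\<close>

lemma moment_condition_if_poly: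
  assumes P: "\<And>u. u \<in> X \<Longrightarrow> \<exists>p. degree p \<le> m - 1 \<and> (\<forall>n. poly p (real n) = N u n)"
  shows "moment_condition M T m \<kappa> v"
  unfolding moment_condition_def
proof
  fix u assume u: "u \<in> X - C"
  obtain k i where i: "i < \<kappa>" and y: "(T ^^ k) u \<in> branches i" using funpow_T_in_branches[OF u] .
  have v0: "v 0 \<in> X" using v_in kappa_pos by simp
  obtain p0 where p0: "degree p0 \<le> m - 1" "\<And>n. poly p0 (real n) = N (v 0) n" using P[OF v0] by blast
  obtain p where p: "degree p \<le> m - 1" "\<And>n. poly p (real n) = N u n" using P[of u] u by blast
  let ?d = "Polynomial.smult (\<mu> (v 0)) (shift_diff_poly (m - 1) (real \<kappa>) p0)"
  \<comment> \<open>These translations align the two sides of the estimate: \<open>?a\<close> by the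
    rest of the turn after \<open>v i\<close>, \<open>?b\<close> by the \<open>k\<close> steps from
    \<open>u\<close> to its branch. Composing with them preserves degrees.\<close>
  let ?a = "[:real \<kappa> - 1 - real i, 1:]" and ?b = "[:real k, 1:]"
  have d: "poly ?d (real n) = cycle_mass 0 (n + \<kappa>) - cycle_mass 0 n" for n
    unfolding poly_smult poly_shift_diff_poly[OF p0(1)]
    by (simp add: cycle_mass_def p0(2)[symmetric] right_diff_distrib)
  have bound: "\<mu> u * N u (n + (\<kappa> - 1 - i)) \<le> poly (pcompose ?d ?b) (real n)" for n
  proof -
    have "\<mu> u * N u (n + (\<kappa> - 1 - i)) \<le> \<mu> ((T ^^ k) u) * N ((T ^^ k) u) (n + (\<kappa> - 1 - i) + k)"
      using mass_funpow_le u by blast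
    also have "\<dots> = \<mu> ((T ^^ k) u) * N ((T ^^ k) u) (n + k + (\<kappa> - 1 - i))" by (simp add: add_ac)
    also have "\<dots> \<le> branch_mass i (n + k + (\<kappa> - 1 - i))"
    proof (rule has_sum_mono'[OF _ branch_mass_has_sum[OF i]])
      show "((\<lambda>y. \<mu> y * N y (n + k + (\<kappa> - 1 - i))) has_sum
          \<mu> ((T ^^ k) u) * N ((T ^^ k) u) (n + k + (\<kappa> - 1 - i))) {(T ^^ k) u}"
        by (simp add: has_sum_finite_iff)
    qed (use y in \<open>auto simp: N_nonneg\<close>)
    also have "\<dots> \<le> (\<Sum>i<\<kappa>. branch_mass i (n + k + (\<kappa> - 1 - i)))"
      using i by (intro member_le_sum) (auto simp: branch_mass_nonneg)
    also have "\<dots> = poly ?d (real (n + k))" unfolding d by (rule cycle_mass_period[symmetric])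
    also have "\<dots> = poly (pcompose ?d ?b) (real n)" by (simp add: poly_pcompose add.commute)
    finally show ?thesis .
  qed
  have pa: "poly (pcompose (Polynomial.smult (\<mu> u) p) ?a) (real n) = \<mu> u * N u (n + (\<kappa> - 1 - i))" for n
  proof -
    have eq: "real n + (real \<kappa> - 1 - real i) = real (n + (\<kappa> - 1 - i))" using i by simp
    have "poly (pcompose (Polynomial.smult (\<mu> u) p) ?a) (real n)
        = \<mu> u * poly p (real n + (real \<kappa> - 1 - real i))" by (simp add: poly_pcompose add.commute)
    then show ?thesis unfolding eq p(2) .
  qed
  have "degree (pcompose (Polynomial.smult (\<mu> u) p) ?a) \<le> degree (pcompose ?d ?b)"
    using bound by (intro degree_le_of_poly_le) (simp_all add: pa N_nonneg)
  moreover have "degree (pcompose (Polynomial.smult (\<mu> u) p) ?a) = degree p"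
    using mu_pos[of u] u by (simp add: degree_pcompose)
  moreover have "degree (pcompose ?d ?b) \<le> m - 2"
    using degree_shift_diff_poly[of "m - 1" "real \<kappa>" p0] by (simp add: degree_pcompose numeral_2_eq_2)
  ultimately have "is_moment_poly M T m u p" using p(2) by (simp add: is_moment_poly_def)
  then show "\<exists>!p. is_moment_poly M T m u p" by (rule moment_poly_unique)
qed

text \<open>On the cycle, \<open>cycle_mass_Suc\<close> solved for the next vertex transfers
  polynomiality from \<open>v 0\<close> onwards: a unit translation and the subtraction of a branch
  polynomial keep the degree bound. Off the cycle the moment polynomial serves.\<close>

lemma poly_if_moment_condition:
  assumes mc: "moment_condition M T m \<kappa> v" and p0: "degree p0 \<le> m - 1" "\<And>n. poly p0 (real n) = N (v 0) n"
    and u: "u \<in> X"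
  shows "\<exists>p. degree p \<le> m - 1 \<and> (\<forall>n. poly p (real n) = N u n)"
proof (cases "u \<in> C")
  case True
  then obtain i where "i < \<kappa>" "u = v i" by auto
  moreover have "\<exists>p. degree p \<le> m - 1 \<and> (\<forall>n. poly p (real n) = cycle_mass i n)" if "i < \<kappa>" for i
    using that
  proof (induction i)
    case 0
    have "degree (Polynomial.smult (\<mu> (v 0)) p0) \<le> m - 1"
      using p0(1) degree_smult_le order.trans by blast
    then show ?case using p0(2) by (intro exI[of _ "Polynomial.smult (\<mu> (v 0)) p0"]) (simp add: cycle_mass_def)
  next
    case (Suc i)
    then obtain p where p: "degree p \<le> m - 1" "\<And>n. poly p (real n) = cycle_mass i n" by auto
    have i: "i < \<kappa>" using Suc.prems by simp
    obtain Q where Q: "degree Q \<le> m - 2" "\<And>n. poly Q (real n) = branch_mass i n"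
      by (rule branch_poly[OF mc i]) blast
    have "poly (pcompose p [:1, 1:] - Q) (real n) = cycle_mass (Suc i) n" for n
      using cycle_mass_Suc[of i n] p(2)[of "Suc n"] Q(2)[of n] Suc.prems by (simp add: poly_pcompose)
    moreover have "degree (pcompose p [:1, 1:] - Q) \<le> m - 1"
      using p(1) Q(1) by (intro degree_diff_le) (auto simp: degree_pcompose)
    ultimately show ?case by blast
  qed
  ultimately obtain p where p: "degree p \<le> m - 1" "\<And>n. poly p (real n) = \<mu> u * N u n"
    unfolding cycle_mass_def by blast
  have "degree (Polynomial.smult (1 / \<mu> u) p) \<le> m - 1"
    using p(1) degree_smult_le order.trans by blast
  then show ?thesis using p(2) mu_pos[OF u] by (intro exI[of _ "Polynomial.smult (1 / \<mu> u) p"]) simp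
next
  case False
  then show ?thesis using moment_polyD[OF mc, of u] u
    by (intro exI[of _ "moment_poly M T m u"]) (auto intro: order.trans)
qed

lemma m_isometric_iff:
  assumes "m \<ge> 2"
  shows "m_isometric X m S \<longleftrightarrow> moment_condition M T m \<kappa> v \<and>
    (\<exists>p. degree p \<le> m - 1 \<and> (\<forall>n. poly p (real n) = N (v 0) n))"
proof -
  have "Suc (m - 1) = m" using assms by simp
  then have iso: "m_isometric X m S \<longleftrightarrow>
      (\<forall>u\<in>X. \<exists>p. degree p \<le> m - 1 \<and> (\<forall>n. poly p (real n) = N u n))"
    using m_isometric_iff_poly[of "m - 1"] by simp
  have v0: "v 0 \<in> X" using v_in kappa_pos by simp
  show ?thesis
  proof
    assume "m_isometric X m S"
    then have P: "\<And>u. u \<in> X \<Longrightarrow> \<exists>p. degree p \<le> m - 1 \<and> (\<forall>n. poly p (real n) = N u n)"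
      unfolding iso by (rule bspec)
    then show "moment_condition M T m \<kappa> v \<and>
        (\<exists>p. degree p \<le> m - 1 \<and> (\<forall>n. poly p (real n) = N (v 0) n))"
      using moment_condition_if_poly[of m] v0 by simp
  next
    assume "moment_condition M T m \<kappa> v \<and> (\<exists>p. degree p \<le> m - 1 \<and> (\<forall>n. poly p (real n) = N (v 0) n))"
    then obtain p0 where mc: "moment_condition M T m \<kappa> v"
      and p0: "degree p0 \<le> m - 1" "\<And>n. poly p0 (real n) = N (v 0) n" by blast
    show "m_isometric X m S" unfolding iso
    proof
      fix u assume "u \<in> X"
      then show "\<exists>p. degree p \<le> m - 1 \<and> (\<forall>n. poly p (real n) = N u n)"
        by (rule poly_if_moment_condition[OF mc p0])
    qed
  qed
qed

section \<open>Solutions of the linear system and the orbit of \<open>v 0\<close>\<close>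

text \<open>At natural arguments \<open>q\<close> takes the increments of \<open>N (v 0)\<close>
  over one turn, and a polynomial identity valid there is valid everywhere.\<close>

lemma A_mat_b_vec_iff:
  assumes m: "m \<ge> 2" and mc: "moment_condition M T m \<kappa> v" and c: "c \<in> carrier_vec m"
  shows "A_mat m \<kappa> *\<^sub>v c = b_vec M T m \<kappa> v \<R> \<longleftrightarrow> poly (poly_of_coeffs m c) 0 = 1 \<and>
    (\<forall>n. poly (poly_of_coeffs m c) (real n + real \<kappa>) - poly (poly_of_coeffs m c) (real n)
      = N (v 0) (n + \<kappa>) - N (v 0) n)"
proof -
  let ?p = "poly_of_coeffs m c" and ?q = "q_poly M T m \<kappa> v \<R>"
  have "(\<forall>n. poly ?p (real n + real \<kappa>) - poly ?p (real n) = poly ?q (real n)) \<longleftrightarrow>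
      (\<forall>x. poly ?p (x + real \<kappa>) - poly ?p x = poly ?q x)"
  proof
    assume *: "\<forall>n. poly ?p (real n + real \<kappa>) - poly ?p (real n) = poly ?q (real n)"
    have "pcompose ?p [:real \<kappa>, 1:] - ?p = ?q"
      using * by (intro poly_eqI_nat) (simp add: poly_pcompose add.commute)
    then have "poly (pcompose ?p [:real \<kappa>, 1:] - ?p) x = poly ?q x" for x by simp
    then show "\<forall>x. poly ?p (x + real \<kappa>) - poly ?p x = poly ?q x"
      by (simp add: poly_pcompose add.commute)
  qed simp
  then show ?thesis
    using A_mat_system_iff[OF c, of ?q \<kappa> 1] m q_polyD(2,3)[OF mc] by (simp add: b_vec_def)
qed

text \<open>The value at 0 and the increments over \<open>\<kappa>\<close> are fixed by the first
  system; what is left are the arguments 1 to \<open>\<kappa> - 1\<close>, one for each row of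
  \<open>B_mat\<close>.\<close>

lemma solution_interpolates_iff:
  assumes m: "m \<ge> 2" and mc: "moment_condition M T m \<kappa> v" and c: "c \<in> carrier_vec m"
    and Ac: "A_mat m \<kappa> *\<^sub>v c = b_vec M T m \<kappa> v \<R>"
  shows "(\<forall>n. poly (poly_of_coeffs m c) (real n) = N (v 0) n) \<longleftrightarrow> B_mat m \<kappa> *\<^sub>v c = a_vec M T \<kappa> v"
proof -
  let ?p = "poly_of_coeffs m c"
  have p0: "poly ?p 0 = 1"
    and diff: "\<And>n. poly ?p (real n + real \<kappa>) - poly ?p (real n) = N (v 0) (n + \<kappa>) - N (v 0) n"
    using Ac unfolding A_mat_b_vec_iff[OF m mc c] by auto
  have N0: "N (v 0) 0 = 1" using N_0 v_in kappa_pos by simp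
  have "B_mat m \<kappa> *\<^sub>v c = a_vec M T \<kappa> v \<longleftrightarrow>
      (\<forall>l<\<kappa> - 1. poly ?p (real (l + 1)) = N (v 0) (l + 1))"
    unfolding B_mat_mult_vec[OF c] a_vec_def by (auto simp: vec_eq_iff)
  also have "\<dots> \<longleftrightarrow> (\<forall>n<\<kappa>. poly ?p (real n) = N (v 0) n)"
  proof
    assume *: "\<forall>l<\<kappa> - 1. poly ?p (real (l + 1)) = N (v 0) (l + 1)"
    show "\<forall>n<\<kappa>. poly ?p (real n) = N (v 0) n"
    proof (intro allI impI)
      fix n assume "n < \<kappa>"
      then show "poly ?p (real n) = N (v 0) n"
        using * p0 N0 by (cases n) auto
    qed
  next
    assume *: "\<forall>n<\<kappa>. poly ?p (real n) = N (v 0) n"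
    show "\<forall>l<\<kappa> - 1. poly ?p (real (l + 1)) = N (v 0) (l + 1)"
    proof (intro allI impI)
      fix l assume "l < \<kappa> - 1"
      then show "poly ?p (real (l + 1)) = N (v 0) (l + 1)" using *[rule_format, of "l + 1"] by simp
    qed
  qed
  also have "\<dots> \<longleftrightarrow> (\<forall>n. poly ?p (real n) = N (v 0) n)"
    using poly_eq_of_shift_diff_eq[OF kappa_pos diff] by blast
  finally show ?thesis by simp
qed

lemma solution_ex1:
  "\<exists>!c. c \<in> carrier_vec m \<and> A_mat m \<kappa> *\<^sub>v c = b_vec M T m \<kappa> v \<R>"
  by (rule nonsing_solution_ex1[OF A_mat_carrier det_A_mat[OF kappa_pos]]) (simp add: b_vec_def)

text \<open>For \<open>\<kappa> = 1\<close> the matrix \<open>B_mat\<close> has no rows, so the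
  first system already forces interpolation; this matches a rank condition imposed only for
  \<open>\<kappa> > 1\<close>.\<close>

lemma rank_condition_iff_interpolates:
  assumes m: "m \<ge> 2" and mc: "moment_condition M T m \<kappa> v" and c: "c \<in> carrier_vec m"
    and Ac: "A_mat m \<kappa> *\<^sub>v c = b_vec M T m \<kappa> v \<R>"
  shows "(\<kappa> > 1 \<longrightarrow> rank_condition M T m \<kappa> v \<R>) \<longleftrightarrow>
    (\<forall>n. poly (poly_of_coeffs m c) (real n) = N (v 0) n)"
proof -
  have "rank_condition M T m \<kappa> v \<R> \<longleftrightarrow> B_mat m \<kappa> *\<^sub>v c = a_vec M T \<kappa> v"
    unfolding rank_condition_iff[OF kappa_pos] using solution_ex1[of m] c Ac by blast
  moreover have "B_mat m \<kappa> *\<^sub>v c = a_vec M T \<kappa> v" if "\<not> \<kappa> > 1"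
    unfolding B_mat_mult_vec[OF c] a_vec_def using that by (intro eq_vecI) auto
  ultimately show ?thesis using solution_interpolates_iff[OF assms] by blast
qed

text \<open>If some polynomial of degree at most \<open>m - 1\<close> interpolates
  \<open>N (v 0)\<close>, its coefficient vector solves the system and hence equals
  \<open>c\<close>. The search for a polynomial thus reduces to one explicit candidate.\<close>

lemma m_isometric_iff_solution_interpolates:
  assumes m: "m \<ge> 2" and c: "c \<in> carrier_vec m" and Ac: "A_mat m \<kappa> *\<^sub>v c = b_vec M T m \<kappa> v \<R>"
  shows "m_isometric X m S \<longleftrightarrow> moment_condition M T m \<kappa> v \<and>
    (\<forall>n. poly (poly_of_coeffs m c) (real n) = N (v 0) n)"
proof -
  have "\<forall>n. poly (poly_of_coeffs m c) (real n) = N (v 0) n"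
    if mc: "moment_condition M T m \<kappa> v" and p: "degree p \<le> m - 1" "\<forall>n. poly p (real n) = N (v 0) n" for p
  proof -
    let ?c = "Matrix.vec m (\<lambda>i. poly.coeff p (m - 1 - i))"
    have pc: "poly_of_coeffs m ?c = p" using p(1) m by (intro poly_of_coeffs_surj) auto
    have "poly p 0 = 1" using p(2)[rule_format, of 0] N_0[OF v_in[of 0]] kappa_pos by simp
    moreover have "poly p (real n + real \<kappa>) = N (v 0) (n + \<kappa>)" for n
      using p(2)[rule_format, of "n + \<kappa>"] by simp
    ultimately have "A_mat m \<kappa> *\<^sub>v ?c = b_vec M T m \<kappa> v \<R>"
      using p(2) unfolding A_mat_b_vec_iff[OF m mc vec_carrier] pc by simp
    then have "c = ?c" using solution_ex1[of m] c Ac by (metis vec_carrier)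
    then show ?thesis using pc p(2) by simp
  qed
  then show ?thesis unfolding m_isometric_iff[OF m] using degree_poly_of_coeffs by blast
qed

end

theorem theorem5p5:
  fixes M :: "'a measure" and T :: "'a \<Rightarrow> 'a"
    and \<kappa> m :: nat and v :: "nat \<Rightarrow> 'a" and \<R> :: "'a set set"
  assumes "discrete_measure_space M"
    and "T \<in> space M \<rightarrow> space M"
    and "esssup M (h_fun M T) < \<infinity>"
    and "Digraph_Component.connected (map_graph M T)"
    and "one_cycle_type_with (map_graph M T) \<kappa> v \<R>"
    and "m \<ge> 2"
  shows
    "(moment_condition M T m \<kappa> v \<longrightarrow> (\<exists>!q. is_q_poly M T m \<kappa> v \<R> q)) \<and>
     (m_isometric (space M) m (shift M T) \<longleftrightarrow>
        moment_condition M T m \<kappa> v \<and> (\<kappa> > 1 \<longrightarrow> rank_condition M T m \<kappa> v \<R>)) \<and>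
     (moment_condition M T m \<kappa> v \<and> (\<kappa> > 1 \<longrightarrow> rank_condition M T m \<kappa> v \<R>) \<longrightarrow>
        (\<exists>!c. c \<in> carrier_vec m \<and> A_mat m \<kappa> *\<^sub>v c = b_vec M T m \<kappa> v \<R>) \<and>
        (\<forall>c. c \<in> carrier_vec m \<and> A_mat m \<kappa> *\<^sub>v c = b_vec M T m \<kappa> v \<R> \<longrightarrow>
           (\<forall>p. (\<forall>n. poly p (real n) = orbit_norm2 M T (v 0) n) \<longleftrightarrow> p = poly_of_coeffs m c)))"
proof -
  interpret one_cycle_shift M T \<kappa> v \<R>
    using assms by unfold_locales
  \<comment> \<open>Nonsingularity of \<open>A_mat\<close> provides \<open>c\<close> before the
    moment condition is known, so both sides of the equivalence can be tested on the same
    vector.\<close>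
  obtain c where c: "c \<in> carrier_vec m" "A_mat m \<kappa> *\<^sub>v c = b_vec M T m \<kappa> v \<R>"
    using solution_ex1[of m] by blast
  note interpolates = rank_condition_iff_interpolates[OF assms(6) _ c]
  have "m_isometric X m S \<longleftrightarrow>
      moment_condition M T m \<kappa> v \<and> (\<kappa> > 1 \<longrightarrow> rank_condition M T m \<kappa> v \<R>)"
    unfolding m_isometric_iff_solution_interpolates[OF assms(6) c] using interpolates by blast
  moreover have "(\<forall>n. poly p (real n) = N (v 0) n) \<longleftrightarrow> p = poly_of_coeffs m c'"
    if mc: "moment_condition M T m \<kappa> v" and rk: "\<kappa> > 1 \<longrightarrow> rank_condition M T m \<kappa> v \<R>"
      and c': "c' \<in> carrier_vec m" "A_mat m \<kappa> *\<^sub>v c' = b_vec M T m \<kappa> v \<R>" for c' p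
  proof -
    have "\<forall>n. poly (poly_of_coeffs m c') (real n) = N (v 0) n"
      using rank_condition_iff_interpolates[OF assms(6) mc c'] rk by blast
    then show ?thesis using poly_eqI_nat[of p "poly_of_coeffs m c'"] by auto
  qed
  ultimately show ?thesis using q_polyD(1)[of m] solution_ex1[of m] by blast
qed

end
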